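(* There exists a universal constant $N_0$ such that the following holds. Let $n\geq 2$ and let $\mu$ be a probability measure on $\mathbb{R}^n$ with density $f=d\mu/dx$ with respect to Lebesgue measure. There exists a probability space $(\Omega,\Im,\mathbb{P})$ and an i.i.d. sequence of random vectors $(X_i)_{1}^{\infty}$ in $\mathbb{R}^n$ defined on $\Omega$ with common distribution $\mu$ such that the following holds. Let $N\in\mathbb{N}$ with $N>N_0$, $y\in\mathbb{R}^n$, $T\in GL(n)$, $0<\varepsilon<1$, and $R>0$, and consider the random measure $$\nu_N=\sum_{i=1}^{N}\delta\left(T^{-1}(X_i-y)\right).$$ Let $B^{\circ}(0,R)=\{x\in\mathbb{R}^n:|x|<R\}$. Assume that $$\int_{|x|<R}\left|\exp\left(-x_1-\pi\sum_{i=2}^{n}x_i^2\right)-N\det(T)f(y+Tx)\right|dx<\varepsilon .$$ Then there exists a Poisson point process $\nu=\nu_\omega$ ($\omega\in\Omega$), defined on $\Omega$, on $B^{\circ}(0,R)$ with intensity measure having density $\exp\left(-x_1-\pi\sum_{i=2}^{n}x_i^2\right)$ such that, with probability at least $$1-\varepsilon-2N^{-1/4}-3\sqrt{\frac{\log N}{N}}\left(1+\int_{|x|<R}\exp\left(-x_1-\pi\sum_{i=2}^{n}x_i^2\right)dx\right),$$ for all Borel sets $E\subseteq B^{\circ}(0,R)$, $$\nu_N(E)=\nu(E).$$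
   Context: $\delta(x)$ denotes the Dirac point mass at the point $x$. $|\cdot|$ is the Euclidean norm on $\mathbb{R}^n$. $GL(n)$ is the group of invertible real $n\times n$ matrices. A Poisson point process is regarded as a random (counting) measure. *)

theory Defs
  imports
    "HOL-Probability.Probability"
    "Jordan_Normal_Form.Determinant"
    "Jordan_Normal_Form.Gauss_Jordan_Elimination"
begin

unbundle no vec_syntax
unbundle no inner_syntax
hide_const (open) Determinants.det Finite_Cartesian_Product.vec Finite_Cartesian_Product.mat
  Finite_Cartesian_Product.row Finite_Cartesian_Product.column
hide_const (open) Finite_Cartesian_Product.transpose

text \<open>
  The constant of the theorem does not depend on the dimension, so the dimension is a natural
  number rather than a type: \<open>\<real>\<^sup>n\<close> is \<^term>\<open>carrier_vec n :: real vec set\<close>, with coordinates indexed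
  from \<open>0\<close>, and linear maps are matrices in \<^term>\<open>carrier_mat n n :: real mat set\<close>.

  The Borel sets of \<open>\<real>\<^sup>n\<close> are the product sets of the coordinate Borel sets, transported along
  the bijection between vectors and extensional functions on \<open>{..<n}\<close>; Lebesgue measure is the
  transported product measure.
\<close>

definition borel_vec :: "nat \<Rightarrow> real vec measure" where
  "borel_vec n = vimage_algebra (carrier_vec n) (\<lambda>v. \<lambda>i\<in>{..<n}. v $ i) (\<Pi>\<^sub>M i\<in>{..<n}. borel)"

definition lborel_vec :: "nat \<Rightarrow> real vec measure" where
  "lborel_vec n = distr (\<Pi>\<^sub>M i\<in>{..<n}. lborel) (borel_vec n) (vec n)"

definition ball_vec :: "nat \<Rightarrow> real \<Rightarrow> real vec set" where
  "ball_vec n R = {x \<in> carrier_vec n. sqrt (x \<bullet> x) < R}"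

text \<open>\<open>exp (- x\<^sub>1 - \<pi> \<Sum>\<^sub>i\<^sub>=\<^sub>2\<^sup>n x\<^sub>i\<^sup>2)\<close>; in zero-based indexing, \<open>x\<^sub>i\<close> is \<open>x $ (i - 1)\<close>.\<close>

definition limit_density :: "nat \<Rightarrow> real vec \<Rightarrow> real" where
  "limit_density n x = exp (- (x $ 0) - pi * (\<Sum>i=1..<n. (x $ i)\<^sup>2))"

definition sum_dirac :: "'a measure \<Rightarrow> 'i set \<Rightarrow> ('i \<Rightarrow> 'a) \<Rightarrow> 'a measure" where
  "sum_dirac L I p = measure_of (space L) (sets L) (\<lambda>E. \<Sum>i\<in>I. emeasure (return L (p i)) E)"

definition random_counting_measure ::
  "'w measure \<Rightarrow> 'a measure \<Rightarrow> ('w \<Rightarrow> 'a measure) \<Rightarrow> bool" where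
  "random_counting_measure M L \<nu> \<longleftrightarrow>
     (\<forall>\<omega>\<in>space M. sets (\<nu> \<omega>) = sets L \<and>
        (\<forall>E\<in>sets L. emeasure (\<nu> \<omega>) E \<in> insert \<infinity> (range of_nat))) \<and>
     (\<forall>E\<in>sets L. (\<lambda>\<omega>. emeasure (\<nu> \<omega>) E) \<in> borel_measurable M)"

text \<open>
  The Poisson probabilities are written out because \<^const>\<open>poisson_pmf\<close> is only specified for
  a positive rate, whereas \<open>\<Lambda> E\<close> may be \<open>0\<close>.
\<close>

definition poisson_point_process ::
  "'w measure \<Rightarrow> 'a measure \<Rightarrow> ('w \<Rightarrow> 'a measure) \<Rightarrow> bool" where
  "poisson_point_process M \<Lambda> \<nu> \<longleftrightarrow>
     random_counting_measure M \<Lambda> \<nu> \<and>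
     (\<forall>E\<in>sets \<Lambda>. emeasure \<Lambda> E < \<infinity> \<longrightarrow>
        (\<forall>k::nat. measure M {\<omega>\<in>space M. emeasure (\<nu> \<omega>) E = of_nat k} =
           exp (- measure \<Lambda> E) * measure \<Lambda> E ^ k / fact k)) \<and>
     (\<forall>E\<in>sets \<Lambda>. emeasure \<Lambda> E = \<infinity> \<longrightarrow> (AE \<omega> in M. emeasure (\<nu> \<omega>) E = \<infinity>)) \<and>
     (\<forall>(m::nat) F. F ` {..<m} \<subseteq> sets \<Lambda> \<and> disjoint_family_on F {..<m} \<longrightarrow>
        prob_space.indep_vars M (\<lambda>_. borel) (\<lambda>j \<omega>. emeasure (\<nu> \<omega>) (F j)) {..<m})"

text \<open>The constructions \<^const>\<open>distr\<close> and \<^const>\<open>measure_of\<close> above are not degenerate.\<close>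

lemma space_borel_vec [simp]: "space (borel_vec n) = carrier_vec n"
  by (simp add: borel_vec_def)

lemma measurable_vec: "vec n \<in> measurable (\<Pi>\<^sub>M i\<in>{..<n}. lborel) (borel_vec n)"
proof -
  have "(\<lambda>x. \<lambda>i\<in>{..<n}. vec n x $ i) \<in> measurable (\<Pi>\<^sub>M i\<in>{..<n}. lborel) (\<Pi>\<^sub>M i\<in>{..<n}. borel)"
    by (rule measurable_restrict) (simp add: measurable_component_singleton)
  then show ?thesis
    unfolding borel_vec_def by (intro measurable_vimage_algebra2) auto
qed

lemma sets_lborel_vec [simp]: "sets (lborel_vec n) = sets (borel_vec n)"
  by (simp add: lborel_vec_def)

lemma space_lborel_vec [simp]: "space (lborel_vec n) = carrier_vec n"
  by (simp add: lborel_vec_def)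

lemma emeasure_lborel_vec_box:
  assumes "\<And>i. i < n \<Longrightarrow> a i \<le> b i"
  shows "emeasure (lborel_vec n) {x \<in> carrier_vec n. \<forall>i<n. a i \<le> x $ i \<and> x $ i \<le> b i} =
    ennreal (\<Prod>i<n. b i - a i)"
proof -
  interpret product_sigma_finite "\<lambda>_::nat. lborel :: real measure" ..
  let ?g = "\<lambda>v::real vec. \<lambda>i\<in>{..<n}. v $ i"
  let ?B = "{x \<in> carrier_vec n. \<forall>i<n. a i \<le> x $ i \<and> x $ i \<le> b i}"
  let ?P = "PiE {..<n} (\<lambda>i. {a i..b i})"
  have B: "?B = ?g -` ?P \<inter> carrier_vec n"
    by (auto simp: PiE_def Pi_def)
  have "?P \<in> sets (\<Pi>\<^sub>M i\<in>{..<n}. borel)"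
    by (intro sets_PiM_I_finite) auto
  then have B_sets: "?B \<in> sets (borel_vec n)"
    unfolding B borel_vec_def by (rule in_vimage_algebra)
  have "vec n -` ?B \<inter> space (\<Pi>\<^sub>M i\<in>{..<n}. lborel) = ?P"
    by (auto simp: space_PiM PiE_def Pi_def)
  then have "emeasure (lborel_vec n) ?B = emeasure (\<Pi>\<^sub>M i\<in>{..<n}. lborel) ?P"
    unfolding lborel_vec_def using emeasure_distr[OF measurable_vec B_sets] by simp
  also have "\<dots> = (\<Prod>i<n. emeasure lborel {a i..b i})"
    by (rule emeasure_PiM) auto
  also have "\<dots> = ennreal (\<Prod>i<n. b i - a i)"
    using assms by (subst prod_ennreal[symmetric]) auto
  finally show ?thesis .
qed

lemma sets_sum_dirac [simp]: "sets (sum_dirac L I p) = sets L"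
  by (simp add: sum_dirac_def)

lemma emeasure_sum_dirac:
  assumes "finite I" "E \<in> sets L"
  shows "emeasure (sum_dirac L I p) E = (\<Sum>i\<in>I. indicator E (p i))"
proof -
  have "countably_additive (sets L) (\<lambda>E. \<Sum>i\<in>I. emeasure (return L (p i)) E)"
  proof (rule countably_additiveI)
    fix A :: "nat \<Rightarrow> _" assume A: "range A \<subseteq> sets L" "disjoint_family A" "\<Union> (range A) \<in> sets L"
    have "(\<Sum>j. \<Sum>i\<in>I. emeasure (return L (p i)) (A j)) =
      (\<Sum>i\<in>I. \<Sum>j. emeasure (return L (p i)) (A j))"
      by (intro suminf_sum) auto
    also have "\<dots> = (\<Sum>i\<in>I. emeasure (return L (p i)) (\<Union> (range A)))"
      using A by (intro sum.cong refl suminf_emeasure) auto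
    finally show "(\<Sum>j. \<Sum>i\<in>I. emeasure (return L (p i)) (A j)) =
      (\<Sum>i\<in>I. emeasure (return L (p i)) (\<Union> (range A)))" .
  qed
  then show ?thesis
    using assms unfolding sum_dirac_def
    by (subst emeasure_measure_of_sigma) (auto simp: positive_def sets.sigma_algebra_axioms)
qed

end

theory Submission
  imports Defs
begin

text \<open>
  Let \<open>Z\<^sub>i = T\<inverse>(X\<^sub>i - y)\<close>, a vector with density \<open>h(x) = \<bar>det T\<bar> f(y + T x)\<close>, let \<open>g\<close> be the limit
  density, and let \<open>K\<close> be a Poisson variable with mean \<open>N\<close>, independent of everything else. Retain
  each of \<open>Z\<^sub>1, \<dots>, Z\<^sub>K\<close> that lies in the ball with probability \<open>min(g, N h) / (N h)\<close> at its
  location, and add an independent Poisson process with intensity the positive part of \<open>g - N h\<close>.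
  The result is a Poisson process with intensity \<open>min(g, N h) + (g - N h)\<^sup>+ = g\<close>. It agrees with
  the first \<open>N\<close> points unless one of these is rejected in the ball (probability at most the integral
  of \<open>(N h - g)\<^sup>+\<close>), or the additional process is not empty (at most the integral of \<open>(g - N h)\<^sup>+\<close>),
  or some point with index between \<open>N\<close> and \<open>K\<close> lies in the ball. The first two add up to at most
  \<open>\<epsilon>\<close>; the last is at most \<open>E \<bar>K - N\<bar> \<integral> h \<le> N\<^sup>-\<^sup>1\<^sup>/\<^sup>2 (1 + \<integral> g)\<close>, because \<open>K\<close> has variance \<open>N\<close>.
\<close>

section \<open>Linear change of variables\<close>

text \<open>The sequence is fixed before \<open>N\<close>, \<open>y\<close>, \<open>T\<close>,
  \<epsilon> and \<open>R\<close>, so the probability space may not depend on the real parameters.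
  Hence each point carries one uniform mark, chosen once, and only the threshold that it is compared
  with depends on the parameters; likewise the process with intensity the positive part of g - N h
  is a thinning of a ready-made process with intensity g on a ball of integer radius. Both sources
  are thus of one kind: a Poisson number of independent marked points, of which those in a
  measurable set are counted. They are treated together, with a Boolean index: \<open>False\<close>
  for the sequence, \<open>True\<close> for the additional process. The joint law of their counts
  comes from generating functions. The factor 1 + int g arises because N int h exceeds int g over
  the ball by less than \<epsilon> < 1. The resulting error N^(-1/2) (1 + int g) is at most the
  third error term of the theorem as soon as N > 1.\<close>

lemma measurable_vec_index [measurable]:
  assumes "i < n"
  shows "(\<lambda>v. v $ i) \<in> borel_measurable (borel_vec n)"
proof -
  have "(\<lambda>v. \<lambda>i\<in>{..<n}. v $ i) \<in> measurable (borel_vec n) (\<Pi>\<^sub>M i\<in>{..<n}. (borel :: real measure))"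
    unfolding borel_vec_def by (rule measurable_vimage_algebra1) (auto simp: space_PiM)
  from measurable_compose[OF this measurable_component_singleton[of i]] assms
  show ?thesis by simp
qed

lemma measurable_lborel_vec_eq [simp]: "measurable (lborel_vec n) N = measurable (borel_vec n) N"
  by (rule measurable_cong_sets) auto

lemmas [measurable_cong] = sets_lborel_vec

lemma measurable_borel_vecI:
  assumes "\<And>\<omega>. \<omega> \<in> space M \<Longrightarrow> X \<omega> \<in> carrier_vec n"
    and [measurable]: "\<And>i. i < n \<Longrightarrow> (\<lambda>\<omega>. X \<omega> $ i) \<in> borel_measurable M"
  shows "X \<in> measurable M (borel_vec n)"
  unfolding borel_vec_def
  by (intro measurable_vimage_algebra2 measurable_restrict) (use assms in \<open>auto simp: space_PiM\<close>)

lemma nn_integral_lborel_vec: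
  assumes "F \<in> borel_measurable (borel_vec n)"
  shows "(\<integral>\<^sup>+x. F x \<partial>lborel_vec n) = (\<integral>\<^sup>+x. F (vec n x) \<partial>(\<Pi>\<^sub>M i\<in>{..<n}. lborel))"
  unfolding lborel_vec_def using measurable_vec assms by (simp add: nn_integral_distr)

text \<open>An affine map that changes only coordinate \<open>k\<close>: by Fubini the change of variables formula
  for such a map is the one-dimensional formula in that coordinate.\<close>

lemma nn_integral_lborel_vec_affine_row:
  assumes F [measurable]: "F \<in> borel_measurable (borel_vec n)" and k: "k < n"
    and r: "r \<in> carrier_vec n" "r $ k \<noteq> 0"
  shows "(\<integral>\<^sup>+x. F x \<partial>lborel_vec n) = ennreal \<bar>r $ k\<bar> *
    (\<integral>\<^sup>+x. F (vec n (\<lambda>i. if i = k then r \<bullet> x + b else x $ i)) \<partial>lborel_vec n)"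
proof -
  interpret product_sigma_finite "\<lambda>_::nat. lborel :: real measure" ..
  let ?I = "{..<n} - {k}"
  let ?P = "\<Pi>\<^sub>M i\<in>{..<n}. (lborel :: real measure)" and ?Q = "\<Pi>\<^sub>M i\<in>?I. (lborel :: real measure)"
  have I: "{..<n} = insert k ?I" using k by auto
  have PI: "Pi\<^sub>M (insert k ?I) (\<lambda>_. lborel) = ?P" "Pi\<^sub>M (insert k {..<n}) (\<lambda>_. lborel) = ?P"
    using I by (auto simp: insert_absorb k)
  define s where "s x = (\<Sum>i\<in>?I. r $ i * x i) + b" for x :: "nat \<Rightarrow> real"
  let ?A = "\<lambda>x. vec n (\<lambda>i. if i = k then r \<bullet> x + b else x $ i)"
  have A: "?A \<in> measurable (borel_vec n) (borel_vec n)"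
  proof (rule measurable_borel_vecI)
    fix i assume "i < n"
    moreover have "(\<lambda>x. r \<bullet> x + b) \<in> borel_measurable (borel_vec n)"
      by (rule measurable_cong[THEN iffD2, of _ _ "\<lambda>x. (\<Sum>i<n. r $ i * x $ i) + b"])
        (auto simp: scalar_prod_def atLeast0LessThan)
    ultimately show "(\<lambda>x. ?A x $ i) \<in> borel_measurable (borel_vec n)"
      by (cases "i = k") auto
  qed simp
  have dot: "r \<bullet> vec n (x(k := y)) + b = s x + r $ k * y" for x y
    using r k by (simp add: scalar_prod_def s_def atLeast0LessThan sum.remove[of "{..<n}" k])
  have V: "vec n \<in> measurable ?P (borel_vec n)" by (rule measurable_vec)
  have "(\<integral>\<^sup>+x. F x \<partial>lborel_vec n) = (\<integral>\<^sup>+x. F (vec n x) \<partial>Pi\<^sub>M (insert k ?I) (\<lambda>_. lborel))"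
    using I by (metis nn_integral_lborel_vec[OF F])
  also have "\<dots> = (\<integral>\<^sup>+x. (\<integral>\<^sup>+y. F (vec n (x(k := y))) \<partial>lborel) \<partial>?Q)"
    using V by (intro product_nn_integral_insert) (auto simp: PI)
  also have "\<dots> = (\<integral>\<^sup>+x. ennreal \<bar>r $ k\<bar> * (\<integral>\<^sup>+y. F (vec n (x(k := s x + r $ k * y))) \<partial>lborel) \<partial>?Q)"
  proof (intro nn_integral_cong)
    fix x assume "x \<in> space ?Q"
    have "(\<lambda>y. F (vec n (x(k := y)))) \<in> borel_measurable borel"
      by (intro measurable_compose[OF measurable_borel_vecI F]) (auto simp: fun_upd_def)
    from nn_integral_real_affine[OF this r(2), of "s x"]
    show "(\<integral>\<^sup>+y. F (vec n (x(k := y))) \<partial>lborel) =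
      ennreal \<bar>r $ k\<bar> * (\<integral>\<^sup>+y. F (vec n (x(k := s x + r $ k * y))) \<partial>lborel)" .
  qed
  also have "\<dots> = (\<integral>\<^sup>+x. ennreal \<bar>r $ k\<bar> * (\<integral>\<^sup>+y. F (?A (vec n (x(k := y)))) \<partial>lborel) \<partial>?Q)"
  proof -
    have "vec n (x(k := s x + r $ k * y)) = ?A (vec n (x(k := y)))" for x y
      by (intro eq_vecI) (auto simp: dot)
    then show ?thesis by simp
  qed
  also have "\<dots> = (\<integral>\<^sup>+x. (\<integral>\<^sup>+y. ennreal \<bar>r $ k\<bar> * F (?A (vec n (x(k := y)))) \<partial>lborel) \<partial>?Q)"
  proof (intro nn_integral_cong nn_integral_cmult[symmetric])
    fix x
    have "(\<lambda>y. vec n (x(k := y))) \<in> measurable lborel (borel_vec n)"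
      by (intro measurable_borel_vecI) (auto simp: fun_upd_def)
    then show "(\<lambda>y. F (?A (vec n (x(k := y))))) \<in> borel_measurable lborel"
      using A F by measurable
  qed
  also have "\<dots> = (\<integral>\<^sup>+x. ennreal \<bar>r $ k\<bar> * F (?A (vec n x)) \<partial>Pi\<^sub>M (insert k ?I) (\<lambda>_. lborel))"
    using V A by (intro product_nn_integral_insert[symmetric]) (auto simp: PI)
  also have "\<dots> = ennreal \<bar>r $ k\<bar> * (\<integral>\<^sup>+x. F (?A (vec n x)) \<partial>?P)"
    using V A by (subst nn_integral_cmult) (auto simp: PI)
  also have "(\<integral>\<^sup>+x. F (?A (vec n x)) \<partial>?P) = (\<integral>\<^sup>+x. F (?A x) \<partial>lborel_vec n)"
    using A by (intro nn_integral_lborel_vec[symmetric]) measurable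
  finally show ?thesis .
qed

lemma measurable_mult_mat_vec [measurable]:
  assumes A: "A \<in> carrier_mat n n"
  shows "(\<lambda>x. A *\<^sub>v x) \<in> measurable (borel_vec n) (borel_vec n)"
proof (rule measurable_borel_vecI)
  fix i assume i: "i < n"
  show "(\<lambda>x. (A *\<^sub>v x) $ i) \<in> borel_measurable (borel_vec n)"
    by (rule measurable_cong[THEN iffD2, of _ _ "\<lambda>x. \<Sum>j<n. A $$ (i, j) * x $ j"])
      (use A i in \<open>auto simp: scalar_prod_def atLeast0LessThan\<close>)
qed (use A in auto)

lemma measurable_add_vec:
  assumes "X \<in> measurable M (borel_vec n)" "Y \<in> measurable M (borel_vec n)"
  shows "(\<lambda>\<omega>. X \<omega> + Y \<omega>) \<in> measurable M (borel_vec n)"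
proof (rule measurable_borel_vecI)
  have *: "X \<omega> \<in> carrier_vec n" "Y \<omega> \<in> carrier_vec n" if "\<omega> \<in> space M" for \<omega>
    using assms[THEN measurable_space] that by auto
  show "X \<omega> + Y \<omega> \<in> carrier_vec n" if "\<omega> \<in> space M" for \<omega> using *[OF that] by simp
  fix i assume i: "i < n"
  have "(\<lambda>\<omega>. X \<omega> $ i + Y \<omega> $ i) \<in> borel_measurable M"
    using assms[THEN measurable_compose, OF measurable_vec_index[OF i]] by measurable
  then show "(\<lambda>\<omega>. (X \<omega> + Y \<omega>) $ i) \<in> borel_measurable M"
    by (rule measurable_cong[THEN iffD2, rotated]) (simp add: i carrier_vecD[OF *(2)])
qed

lemma measurable_minus_vec:
  assumes "X \<in> measurable M (borel_vec n)" "Y \<in> measurable M (borel_vec n)"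
  shows "(\<lambda>\<omega>. X \<omega> - Y \<omega>) \<in> measurable M (borel_vec n)"
proof (rule measurable_borel_vecI)
  have *: "X \<omega> \<in> carrier_vec n" "Y \<omega> \<in> carrier_vec n" if "\<omega> \<in> space M" for \<omega>
    using assms[THEN measurable_space] that by auto
  show "X \<omega> - Y \<omega> \<in> carrier_vec n" if "\<omega> \<in> space M" for \<omega> using *[OF that] by simp
  fix i assume i: "i < n"
  have "(\<lambda>\<omega>. X \<omega> $ i - Y \<omega> $ i) \<in> borel_measurable M"
    using assms[THEN measurable_compose, OF measurable_vec_index[OF i]] by measurable
  then show "(\<lambda>\<omega>. (X \<omega> - Y \<omega>) $ i) \<in> borel_measurable M"
    by (rule measurable_cong[THEN iffD2, rotated]) (simp add: i carrier_vecD[OF *(2)])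
qed

text \<open>The translation is done one coordinate at a time: \<open>t m\<close> is \<open>y\<close>
  with all coordinates from \<open>m\<close> on set to 0, and passing from \<open>t m\<close> to
  \<open>t (Suc m)\<close> is an affine row map with row \<open>unit_vec n m\<close>, whose factor
  is 1.\<close>

lemma nn_integral_lborel_vec_translation:
  assumes F [measurable]: "F \<in> borel_measurable (borel_vec n)" and y: "y \<in> carrier_vec n"
  shows "(\<integral>\<^sup>+x. F x \<partial>lborel_vec n) = (\<integral>\<^sup>+x. F (y + x) \<partial>lborel_vec n)"
proof -
  define t where "t m = vec n (\<lambda>i. if i < m then y $ i else 0)" for m
  have "m \<le> n \<Longrightarrow> (\<integral>\<^sup>+x. F x \<partial>lborel_vec n) = (\<integral>\<^sup>+x. F (t m + x) \<partial>lborel_vec n)" for m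
  proof (induction m)
    case 0
    show ?case by (intro nn_integral_cong arg_cong[where f=F]) (auto simp: t_def)
  next
    case (Suc m)
    then have m: "m < n" by simp
    have "(\<lambda>x. t m + x) \<in> measurable (borel_vec n) (borel_vec n)"
      by (intro measurable_add_vec) (auto simp: t_def)
    then have "(\<lambda>x. F (t m + x)) \<in> borel_measurable (borel_vec n)" by measurable
    from nn_integral_lborel_vec_affine_row[OF this m, of "unit_vec n m" "y $ m"] m Suc
    have "(\<integral>\<^sup>+x. F x \<partial>lborel_vec n) = (\<integral>\<^sup>+x.
      F (t m + vec n (\<lambda>i. if i = m then unit_vec n m \<bullet> x + y $ m else x $ i)) \<partial>lborel_vec n)"
      by simp
    also have "\<dots> = (\<integral>\<^sup>+x. F (t (Suc m) + x) \<partial>lborel_vec n)"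
      using m by (intro nn_integral_cong arg_cong[where f=F] eq_vecI)
        (auto simp: t_def scalar_prod_left_unit less_Suc_eq)
    finally show ?case .
  qed
  from this[of n] show ?thesis
    using y by (simp add: t_def cong: nn_integral_cong) (auto intro!: nn_integral_cong arg_cong[where f=F])
qed

section \<open>Linear maps that change one coordinate\<close>

definition row_mat :: "nat \<Rightarrow> nat \<Rightarrow> real vec \<Rightarrow> real mat" where
  "row_mat n k r = mat n n (\<lambda>(i, j). if i = k then r $ j else if i = j then 1 else 0)"

lemma row_mat_carrier [simp]: "row_mat n k r \<in> carrier_mat n n"
  by (simp add: row_mat_def)

lemma dim_row_row_mat [simp]: "dim_row (row_mat n k r) = n"
  by (simp add: row_mat_def)

lemma row_row_mat:
  "i < n \<Longrightarrow> r \<in> carrier_vec n \<Longrightarrow> row (row_mat n k r) i = (if i = k then r else unit_vec n i)"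
  by (intro eq_vecI) (auto simp: row_mat_def)

text \<open>The transposed matrix is the identity with column \<open>k\<close> replaced by
  \<open>r\<close>, that is, by the image of \<open>r\<close> under the identity, so Cramer's rule
  gives the determinant.\<close>

lemma det_row_mat:
  assumes r: "r \<in> carrier_vec n" and k: "k < n"
  shows "det (row_mat n k r) = r $ k"
proof -
  have "transpose_mat (row_mat n k r) = replace_col (1\<^sub>m n) (1\<^sub>m n *\<^sub>v r) k"
    using r by (intro eq_matI) (auto simp: row_mat_def replace_col_def)
  then show ?thesis
    using cramer_lemma_mat[OF one_carrier_mat r k] det_transpose[OF row_mat_carrier[of n k r]] by simp
qed

lemma nn_integral_lborel_vec_row_mat:
  assumes F: "F \<in> borel_measurable (borel_vec n)" and r: "r \<in> carrier_vec n" "r $ k \<noteq> 0" and k: "k < n"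
  shows "(\<integral>\<^sup>+x. F x \<partial>lborel_vec n) =
    ennreal \<bar>det (row_mat n k r)\<bar> * (\<integral>\<^sup>+x. F (row_mat n k r *\<^sub>v x) \<partial>lborel_vec n)"
proof -
  have "vec n (\<lambda>i. if i = k then r \<bullet> x + 0 else x $ i) = row_mat n k r *\<^sub>v x"
    if "x \<in> carrier_vec n" for x
    using that r k by (intro eq_vecI) (auto simp: row_row_mat scalar_prod_left_unit)
  then have "(\<integral>\<^sup>+x. F (vec n (\<lambda>i. if i = k then r \<bullet> x + 0 else x $ i)) \<partial>lborel_vec n) =
      (\<integral>\<^sup>+x. F (row_mat n k r *\<^sub>v x) \<partial>lborel_vec n)"
    by (intro nn_integral_cong) simp
  then show ?thesis
    using nn_integral_lborel_vec_affine_row[OF F k r, of 0] r k by (simp add: det_row_mat)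
qed

text \<open>The matrices \<open>A\<close> satisfying the change of variables formula are closed under products.
  Reducing an invertible matrix to the identity by column operations, from the last row upwards,
  writes it as a product of row matrices.\<close>

definition change_of_vars_mat :: "nat \<Rightarrow> real mat \<Rightarrow> bool" where
  "change_of_vars_mat n A \<longleftrightarrow> (\<forall>F\<in>borel_measurable (borel_vec n).
     (\<integral>\<^sup>+x. F x \<partial>lborel_vec n) = ennreal \<bar>det A\<bar> * (\<integral>\<^sup>+x. F (A *\<^sub>v x) \<partial>lborel_vec n))"

lemma change_of_vars_mat_mult:
  assumes A: "A \<in> carrier_mat n n" "change_of_vars_mat n A"
    and B: "B \<in> carrier_mat n n" "change_of_vars_mat n B"
  shows "change_of_vars_mat n (A * B)"
  unfolding change_of_vars_mat_def
proof
  fix F :: "real vec \<Rightarrow> ennreal" assume F: "F \<in> borel_measurable (borel_vec n)"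
  have FA: "(\<lambda>x. F (A *\<^sub>v x)) \<in> borel_measurable (borel_vec n)"
    using F A by measurable
  have "(\<integral>\<^sup>+x. F x \<partial>lborel_vec n) = ennreal \<bar>det A\<bar> * (\<integral>\<^sup>+x. F (A *\<^sub>v x) \<partial>lborel_vec n)"
    using A(2) F unfolding change_of_vars_mat_def by (rule bspec)
  also have "(\<integral>\<^sup>+x. F (A *\<^sub>v x) \<partial>lborel_vec n) =
      ennreal \<bar>det B\<bar> * (\<integral>\<^sup>+x. F (A *\<^sub>v (B *\<^sub>v x)) \<partial>lborel_vec n)"
    using B(2) FA unfolding change_of_vars_mat_def by (rule bspec)
  also have "(\<integral>\<^sup>+x. F (A *\<^sub>v (B *\<^sub>v x)) \<partial>lborel_vec n) = (\<integral>\<^sup>+x. F (A * B *\<^sub>v x) \<partial>lborel_vec n)"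
    using A B by (intro nn_integral_cong) auto
  finally show "(\<integral>\<^sup>+x. F x \<partial>lborel_vec n) =
      ennreal \<bar>det (A * B)\<bar> * (\<integral>\<^sup>+x. F (A * B *\<^sub>v x) \<partial>lborel_vec n)"
    using A B by (simp add: det_mult[of A n B] abs_mult ennreal_mult mult.assoc)
qed

text \<open>Right multiplication by \<open>row_mat n k r\<close> scales column \<open>k\<close> by
  \<open>r $ k\<close> and adds \<open>r $ j\<close> times column \<open>k\<close> to every other
  column \<open>j\<close>; \<open>A'\<close> results from undoing this. Its entries are part of the
  conclusion because the reduction below has to follow single entries.\<close>

lemma factor_row_mat:
  fixes A :: "real mat"
  assumes A: "A \<in> carrier_mat n n" and r: "r \<in> carrier_vec n" "r $ k \<noteq> 0" and k: "k < n"
  obtains A' where "A' \<in> carrier_mat n n" "A = A' * row_mat n k r"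
    "\<And>i j. i < n \<Longrightarrow> j < n \<Longrightarrow>
      A' $$ (i, j) = (if j = k then A $$ (i, k) / r $ k else A $$ (i, j) - A $$ (i, k) / r $ k * r $ j)"
proof
  let ?A = "mat n n (\<lambda>(i, j). if j = k then A $$ (i, k) / r $ k
    else A $$ (i, j) - A $$ (i, k) / r $ k * r $ j)"
  show "?A \<in> carrier_mat n n" by simp
  show "A = ?A * row_mat n k r"
  proof (rule eq_matI)
    fix i j assume "i < dim_row (?A * row_mat n k r)" "j < dim_col (?A * row_mat n k r)"
    then have ij: "i < n" "j < n" by (auto simp: row_mat_def)
    have "(?A * row_mat n k r) $$ (i, j) = (\<Sum>l<n. ?A $$ (i, l) * row_mat n k r $$ (l, j))"
      using ij by (simp add: scalar_prod_def row_mat_def atLeast0LessThan)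
    also have "\<dots> = ?A $$ (i, k) * r $ j + (\<Sum>l\<in>{..<n} - {k}. ?A $$ (i, l) * row_mat n k r $$ (l, j))"
      using k ij by (subst sum.remove[of _ k]) (auto simp: row_mat_def)
    also have "(\<Sum>l\<in>{..<n} - {k}. ?A $$ (i, l) * row_mat n k r $$ (l, j)) =
        (\<Sum>l\<in>{..<n} - {k}. if l = j then ?A $$ (i, j) else 0)"
      using ij by (intro sum.cong) (auto simp: row_mat_def)
    also have "\<dots> = (if j = k then 0 else ?A $$ (i, j))"
      using ij by (simp add: sum.delta)
    finally have "(?A * row_mat n k r) $$ (i, j) =
      ?A $$ (i, k) * r $ j + (if j = k then 0 else ?A $$ (i, j))" .
    then show "A $$ (i, j) = (?A * row_mat n k r) $$ (i, j)"
      using ij r k by simp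
  qed (use A in \<open>auto simp: row_mat_def\<close>)
qed auto

lemma change_of_vars_mat_step:
  assumes "A' \<in> carrier_mat n n" "r \<in> carrier_vec n" "r $ k \<noteq> 0" "k < n"
    and "change_of_vars_mat n A'"
  shows "change_of_vars_mat n (A' * row_mat n k r)"
proof (rule change_of_vars_mat_mult[OF assms(1,5) row_mat_carrier])
  show "change_of_vars_mat n (row_mat n k r)"
    unfolding change_of_vars_mat_def
    by (intro ballI nn_integral_lborel_vec_row_mat assms)
qed

text \<open>\<open>m\<close> counts the top rows that are still arbitrary. Splitting off
  \<open>row_mat n k (row B k)\<close> turns row \<open>k\<close> into a unit row, and the unit rows
  below survive because they vanish in column \<open>k\<close>.\<close>

lemma change_of_vars_mat_unit_rows:
  assumes "A \<in> carrier_mat n n" "det A \<noteq> 0" "m \<le> n"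
    and "\<And>i j. m \<le> i \<Longrightarrow> i < n \<Longrightarrow> j < n \<Longrightarrow> A $$ (i, j) = (if i = j then 1 else 0)"
  shows "change_of_vars_mat n A"
  using assms
proof (induction m arbitrary: A)
  case 0
  then have "A = 1\<^sub>m n" by (intro eq_matI) auto
  then show ?case by (auto simp: change_of_vars_mat_def intro!: nn_integral_cong)
next
  case (Suc k)
  then have k: "k < n" by simp
  have pivot: "change_of_vars_mat n B"
    if B: "B \<in> carrier_mat n n" "det B \<noteq> 0" "B $$ (k, k) \<noteq> 0"
      "\<And>i j. Suc k \<le> i \<Longrightarrow> i < n \<Longrightarrow> j < n \<Longrightarrow> B $$ (i, j) = (if i = j then 1 else 0)" for B
  proof -
    have r: "row B k \<in> carrier_vec n" "row B k $ k \<noteq> 0" using B(1,3) k by auto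
    obtain B' where B': "B' \<in> carrier_mat n n" "B = B' * row_mat n k (row B k)"
      "\<And>i j. i < n \<Longrightarrow> j < n \<Longrightarrow> B' $$ (i, j) = (if j = k then B $$ (i, k) / row B k $ k
        else B $$ (i, j) - B $$ (i, k) / row B k $ k * row B k $ j)"
      by (rule factor_row_mat[OF B(1) r k]) (rule that)
    have "det B = det B' * det (row_mat n k (row B k))"
      by (subst B'(2), rule det_mult) (use B'(1) in auto)
    then have "det B' \<noteq> 0" using B(2) by auto
    moreover have "B' $$ (i, j) = (if i = j then 1 else 0)" if "k \<le> i" "i < n" "j < n" for i j
      using that B(1,3) B(4)[of i] k by (cases "i = k") (auto simp: B'(3))
    ultimately have "change_of_vars_mat n B'"
      using Suc.IH[of B'] B'(1) k by simp
    then show ?thesis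
      by (subst B'(2)) (rule change_of_vars_mat_step[OF B'(1) r k])
  qed
  show ?case
  proof (cases "A $$ (k, k) = 0")
    case False
    then show ?thesis using pivot[of A] Suc by blast
  next
    case True
    \<comment> \<open>If row \<open>k\<close> vanished on and to the left of the diagonal, it would
      be a combination of the unit rows below it; \<open>v\<close> holds the coefficients of this
      linear dependence.\<close>
    have "\<exists>l<k. A $$ (k, l) \<noteq> 0"
    proof (rule ccontr)
      assume no: "\<not> (\<exists>l<k. A $$ (k, l) \<noteq> 0)"
      define v where "v = vec n (\<lambda>i. if i < k then 0 else if i = k then 1 else - A $$ (k, i))"
      have "transpose_mat A *\<^sub>v v = 0\<^sub>v n"
      proof (rule eq_vecI)
        fix j assume "j < dim_vec (0\<^sub>v n :: real vec)"
        then have j: "j < n" by simp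
        have "(transpose_mat A *\<^sub>v v) $ j = (\<Sum>i<n. A $$ (i, j) * v $ i)"
          using j Suc(2) by (simp add: scalar_prod_def v_def atLeast0LessThan)
        also have "\<dots> = A $$ (k, j) + (\<Sum>i\<in>{..<n} - {k}. A $$ (i, j) * v $ i)"
          using k by (subst sum.remove[of _ k]) (auto simp: v_def)
        also have "(\<Sum>i\<in>{..<n} - {k}. A $$ (i, j) * v $ i) =
          (\<Sum>i\<in>{..<n} - {k}. if i = j then (if k < j then - A $$ (k, j) else 0) else 0)"
          using Suc(5) j by (intro sum.cong) (auto simp: v_def)
        also have "\<dots> = (if k < j then - A $$ (k, j) else 0)"
          using j by (simp add: sum.delta)
        finally show "(transpose_mat A *\<^sub>v v) $ j = 0\<^sub>v n $ j"
          using j no True by (cases j k rule: linorder_cases) auto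
      qed (use Suc(2) in auto)
      moreover have "v \<in> carrier_vec n" "v $ k = 1" using k by (auto simp: v_def)
      then have "v \<in> carrier_vec n" "v \<noteq> 0\<^sub>v n" using k by auto
      ultimately have "det (transpose_mat A) = 0"
        using det_0_iff_vec_prod_zero[of "transpose_mat A" n] Suc(2) by auto
      then show False using Suc(2,3) det_transpose[OF Suc(2)] by simp
    qed
    then obtain l where l: "l < k" "A $$ (k, l) \<noteq> 0" by auto
    \<comment> \<open>Splitting off this row adds column \<open>l\<close> to column
      \<open>k\<close>: the new diagonal entry is \<open>A $$ (k, l)\<close>, while the rows below
      \<open>k\<close> vanish in column \<open>l\<close> and stay as they are.\<close>
    define r :: "real vec" where "r = unit_vec n l - unit_vec n k"
    have r: "r \<in> carrier_vec n" "r $ l \<noteq> 0" "l < n" "r $ l = 1" "r $ k = -1"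
      using l k by (auto simp: r_def)
    obtain B where B: "B \<in> carrier_mat n n" "A = B * row_mat n l r"
      "\<And>i j. i < n \<Longrightarrow> j < n \<Longrightarrow> B $$ (i, j) = (if j = l then A $$ (i, l) / r $ l
        else A $$ (i, j) - A $$ (i, l) / r $ l * r $ j)"
      by (rule factor_row_mat[OF Suc(2) r(1,2,3)]) (rule that)
    have "det A = det B * det (row_mat n l r)"
      by (subst B(2), rule det_mult) (use B(1) in auto)
    then have "det B \<noteq> 0" using Suc(3) by auto
    moreover have "B $$ (i, j) = (if i = j then 1 else 0)" if "Suc k \<le> i" "i < n" "j < n" for i j
      using that l k r Suc(5) by (auto simp: B(3))
    moreover have "B $$ (k, k) \<noteq> 0" using l k r True by (simp add: B(3))
    ultimately have "change_of_vars_mat n B" using pivot[of B] B(1) by blast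
    then show ?thesis using change_of_vars_mat_step[OF B(1) r(1-3)] B(2) by simp
  qed
qed

lemma nn_integral_lborel_vec_affine:
  assumes F [measurable]: "F \<in> borel_measurable (borel_vec n)" and y: "y \<in> carrier_vec n"
    and A: "A \<in> carrier_mat n n" "det A \<noteq> 0"
  shows "(\<integral>\<^sup>+x. F x \<partial>lborel_vec n) =
    ennreal \<bar>det A\<bar> * (\<integral>\<^sup>+x. F (y + A *\<^sub>v x) \<partial>lborel_vec n)"
proof -
  have "change_of_vars_mat n A"
    using change_of_vars_mat_unit_rows[OF A, of n] by simp
  moreover have "(\<lambda>x. F (y + x)) \<in> borel_measurable (borel_vec n)"
    by (rule measurable_compose[OF measurable_add_vec F]) (use y in auto)
  ultimately show ?thesis
    unfolding nn_integral_lborel_vec_translation[OF F y] change_of_vars_mat_def by blast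
qed

text \<open>The change of variables is applied to \<open>f\<close> times the indicator of the
  preimage of a test set; \<open>S\<close> undoes \<open>T\<close>, which turns that indicator back
  into the one of the set.\<close>

lemma distr_density_affine:
  assumes f [measurable]: "f \<in> borel_measurable (borel_vec n)" and y: "y \<in> carrier_vec n"
    and T: "T \<in> carrier_mat n n" and S: "S \<in> carrier_mat n n" "S * T = 1\<^sub>m n"
  shows "distr (density (lborel_vec n) f) (borel_vec n) (\<lambda>x. S *\<^sub>v (x - y)) =
    density (lborel_vec n) (\<lambda>x. ennreal \<bar>det T\<bar> * f (y + T *\<^sub>v x))"
proof (rule measure_eqI)
  have "det S * det T = 1" using det_mult[OF S(1) T] S(2) by simp
  then have T0: "det T \<noteq> 0" by auto
  let ?g = "\<lambda>x. S *\<^sub>v (x - y)"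
  have m1: "?g \<in> measurable (borel_vec n) (borel_vec n)"
    using measurable_compose[OF measurable_minus_vec measurable_mult_mat_vec[OF S(1)], of "\<lambda>x. x" "borel_vec n" "\<lambda>_. y"] y
    by simp
  have m2: "(\<lambda>x. y + T *\<^sub>v x) \<in> measurable (borel_vec n) (borel_vec n)"
    using y T by (intro measurable_add_vec) auto
  have inv: "?g (y + T *\<^sub>v x) = x" if "x \<in> carrier_vec n" for x
  proof -
    have "y + T *\<^sub>v x - y = T *\<^sub>v x" using y T that by (intro eq_vecI) auto
    then show ?thesis using that S T by (simp flip: assoc_mult_mat_vec[of S n n T n x])
  qed
  fix E assume "E \<in> sets (distr (density (lborel_vec n) f) (borel_vec n) ?g)"
  then have E [measurable]: "E \<in> sets (borel_vec n)" by simp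
  have "emeasure (distr (density (lborel_vec n) f) (borel_vec n) ?g) E =
      (\<integral>\<^sup>+x. indicator E (?g x) \<partial>density (lborel_vec n) f)"
    using m1 by (subst nn_integral_indicator[symmetric], simp, subst nn_integral_distr) auto
  also have "\<dots> = (\<integral>\<^sup>+x. f x * indicator E (?g x) \<partial>lborel_vec n)"
    using m1 by (subst nn_integral_density) auto
  also have "\<dots> = ennreal \<bar>det T\<bar> * (\<integral>\<^sup>+x. f (y + T *\<^sub>v x) * indicator E (?g (y + T *\<^sub>v x)) \<partial>lborel_vec n)"
    using m1 by (intro nn_integral_lborel_vec_affine[OF _ y T T0]) auto
  also have "\<dots> = (\<integral>\<^sup>+x. ennreal \<bar>det T\<bar> * (f (y + T *\<^sub>v x) * indicator E x) \<partial>lborel_vec n)"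
    using m1 m2 by (subst nn_integral_cmult[symmetric]) (auto simp: inv intro!: nn_integral_cong)
  also have "\<dots> = emeasure (density (lborel_vec n) (\<lambda>x. ennreal \<bar>det T\<bar> * f (y + T *\<^sub>v x))) E"
    using m2 by (subst emeasure_density) (auto simp: mult.assoc)
  finally show "emeasure (distr (density (lborel_vec n) f) (borel_vec n) ?g) E =
    emeasure (density (lborel_vec n) (\<lambda>x. ennreal \<bar>det T\<bar> * f (y + T *\<^sub>v x))) E" .
qed simp

section \<open>Superposition of compound Poisson variables\<close>

text \<open>Strong induction: with the lower coefficients gone, dividing by \<open>t ^ m\<close>
  leaves a series with constant term \<open>c m\<close> that vanishes on (0,1), so its limit from
  the right at 0 is both \<open>c m\<close> and 0.\<close>

lemma power_series_coeff_eq_0: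
  fixes c :: "nat \<Rightarrow> real"
  assumes "\<And>t. 0 < t \<Longrightarrow> t < 1 \<Longrightarrow> (\<lambda>k. c k * t ^ k) sums 0"
  shows "c m = 0"
proof (induction m rule: less_induct)
  case (less m)
  let ?a = "\<lambda>k. c (k + m)"
  have sums0: "(\<lambda>k. ?a k * t ^ k) sums 0" if t: "0 < t" "t < 1" for t
  proof -
    have "(\<lambda>k. c (k + m) * t ^ (k + m)) sums (0 - (\<Sum>k<m. c k * t ^ k))"
      using sums_split_initial_segment[OF assms[OF t]] .
    also have "(\<Sum>k<m. c k * t ^ k) = 0" using less by simp
    finally have "(\<lambda>k. inverse (t ^ m) * (c (k + m) * t ^ (k + m))) sums (inverse (t ^ m) * (0 - 0))"
      by (rule sums_mult)
    then show ?thesis using t by (simp add: power_add field_simps)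
  qed
  let ?g = "\<lambda>x. \<Sum>k. ?a k * x ^ k"
  have "(?g \<longlongrightarrow> ?a 0) (at 0)"
  proof (rule powser_limit_0)
    \<comment> \<open>Convergence is wanted on both sides of 0; it follows from convergence at the
      positive point \<open>(norm x + 1) / 2\<close>, which exceeds \<open>norm x\<close>.\<close>
    fix x :: real assume "norm x < 1"
    then show "(\<lambda>k. ?a k * x ^ k) sums ?g x"
      using powser_inside[of ?a "(norm x + 1) / 2" x] sums0[of "(norm x + 1) / 2"]
      by (auto simp: sums_iff)
  qed simp
  then have "(?g \<longlongrightarrow> c m) (at_right 0)"
    by (simp add: filterlim_at_split)
  moreover have "(?g \<longlongrightarrow> 0) (at_right 0)"
  proof (rule tendsto_eventually)
    have "\<forall>\<^sub>F x in at_right (0::real). x \<in> {0<..<1}"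
      by (rule eventually_at_right_real) simp
    then show "\<forall>\<^sub>F x in at_right 0. ?g x = 0"
      by eventually_elim (use sums0 in \<open>auto simp: sums_iff\<close>)
  qed
  ultimately show "c m = 0"
    by (rule tendsto_unique[rotated]) simp
qed

text \<open>The partial sums are expectations of \<open>F\<close> on the events
  \<open>K < n\<close>, so dominated convergence applies. This takes the place of conditioning on
  the Poisson number of points.\<close>

lemma (in prob_space) sums_expectation_nat_valued:
  fixes F :: "'a \<Rightarrow> real"
  assumes [measurable]: "K \<in> measurable M (count_space UNIV)" "F \<in> borel_measurable M"
    and F: "integrable M F"
  shows "(\<lambda>k. expectation (\<lambda>\<omega>. F \<omega> * of_bool (K \<omega> = (k::nat)))) sums expectation F"
proof -
  have int: "integrable M (\<lambda>\<omega>. F \<omega> * of_bool (K \<omega> = k))" for k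
    by (rule Bochner_Integration.integrable_bound[OF F]) auto
  have "(\<lambda>n. expectation (\<lambda>\<omega>. F \<omega> * of_bool (K \<omega> < n))) \<longlonglongrightarrow> expectation F"
  proof (rule integral_dominated_convergence[where w="\<lambda>\<omega>. \<bar>F \<omega>\<bar>"])
    show "AE \<omega> in M. (\<lambda>n. F \<omega> * of_bool (K \<omega> < n)) \<longlonglongrightarrow> F \<omega>"
    proof (rule AE_I2, rule tendsto_eventually)
      show "\<forall>\<^sub>F n in sequentially. F \<omega> * of_bool (K \<omega> < n) = F \<omega>" for \<omega>
        using eventually_gt_at_top[of "K \<omega>"] by eventually_elim simp
    qed
  qed (use F in auto)
  also have "(\<lambda>n. expectation (\<lambda>\<omega>. F \<omega> * of_bool (K \<omega> < n))) =
      (\<lambda>n. \<Sum>k<n. expectation (\<lambda>\<omega>. F \<omega> * of_bool (K \<omega> = k)))"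
  proof
    fix n
    have "(\<Sum>k<n. F \<omega> * of_bool (K \<omega> = k)) = F \<omega> * of_bool (K \<omega> < n)" for \<omega>
      by (cases "K \<omega> < n") (simp_all add: sum.delta of_bool_def if_distrib cong: if_cong)
    from this[symmetric] show "expectation (\<lambda>\<omega>. F \<omega> * of_bool (K \<omega> < n)) =
        (\<Sum>k<n. expectation (\<lambda>\<omega>. F \<omega> * of_bool (K \<omega> = k)))"
      by (simp only: Bochner_Integration.integral_sum[OF int])
  qed
  finally show ?thesis by (simp add: sums_def)
qed

lemma (in prob_space) expectation_of_bool:
  "expectation (\<lambda>\<omega>. of_bool (P \<omega>)) = prob {\<omega>\<in>space M. P \<omega>}"
proof -
  have "expectation (\<lambda>\<omega>. of_bool (P \<omega>)) = expectation (indicator {\<omega>\<in>space M. P \<omega>})"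
    by (intro Bochner_Integration.integral_cong) auto
  also have "\<dots> = prob ({\<omega>\<in>space M. P \<omega>} \<inter> space M)"
    by (rule Bochner_Integration.integral_indicator)
  also have "{\<omega>\<in>space M. P \<omega>} \<inter> space M = {\<omega>\<in>space M. P \<omega>}" by auto
  finally show ?thesis .
qed

text \<open>Meaningful also for rate 0, which occurs for null sets; there \<open>0 ^ 0 = 1\<close>
  makes it the point mass at 0.\<close>

definition poisson_prob :: "real \<Rightarrow> nat \<Rightarrow> real" where
  "poisson_prob a k = exp (- a) * a ^ k / fact k"

lemma sums_poisson_prob_power:
  "(\<lambda>k. poisson_prob a k * t ^ k) sums exp (a * (t - 1))"
proof -
  have "(\<lambda>k. exp (- a) * ((a * t) ^ k /\<^sub>R fact k)) sums (exp (- a) * exp (a * t))"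
    by (intro sums_mult exp_converges)
  then show ?thesis
    by (simp add: poisson_prob_def power_mult_distrib mult_ac divide_inverse algebra_simps
        flip: exp_add)
qed

text \<open>A joint probability generating function determines the joint law: one variable \<open>z j\<close> at a
  time is traded for the event \<open>C j = k j\<close> by comparing power series coefficients.\<close>

lemma (in prob_space) joint_poisson_of_pgf:
  fixes C :: "'i \<Rightarrow> 'a \<Rightarrow> nat"
  assumes J: "finite J"
    and C [measurable]: "\<And>j. j \<in> J \<Longrightarrow> C j \<in> measurable M (count_space UNIV)"
    and pgf: "\<And>z. (\<And>j. j \<in> J \<Longrightarrow> 0 \<le> z j \<and> z j \<le> 1) \<Longrightarrow>
      expectation (\<lambda>\<omega>. \<Prod>j\<in>J. z j ^ C j \<omega>) = (\<Prod>j\<in>J. exp (a j * (z j - 1)))"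
  shows "prob {\<omega>\<in>space M. \<forall>j\<in>J. C j \<omega> = k j} = (\<Prod>j\<in>J. poisson_prob (a j) (k j))"
proof -
  \<comment> \<open>\<open>R\<close> is the set of indices already traded for events; the others
    keep their variable \<open>z j\<close>.\<close>
  have "expectation (\<lambda>\<omega>. (\<Prod>j\<in>R. of_bool (C j \<omega> = k j)) * (\<Prod>j\<in>J - R. z j ^ C j \<omega>)) =
      (\<Prod>j\<in>R. poisson_prob (a j) (k j)) * (\<Prod>j\<in>J - R. exp (a j * (z j - 1)))"
    if "R \<subseteq> J" "\<And>j. j \<in> J \<Longrightarrow> 0 \<le> z j \<and> z j \<le> 1" for R z
    using finite_subset[OF that(1) J] that
  proof (induction R arbitrary: z rule: finite_induct)
    case empty
    then show ?case using pgf by simp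
  next
    case (insert r R)
    let ?J = "J - insert r R"
    let ?H = "\<lambda>\<omega>. (\<Prod>j\<in>R. of_bool (C j \<omega> = k j)) * (\<Prod>j\<in>?J. z j ^ C j \<omega>) :: real"
    let ?p = "(\<Prod>j\<in>R. poisson_prob (a j) (k j)) * (\<Prod>j\<in>?J. exp (a j * (z j - 1)))"
    have r: "r \<in> J" "r \<notin> R" "R \<subseteq> J" "finite R" and JR: "J - R = insert r ?J" "finite ?J" "r \<notin> ?J"
      using insert J by auto
    have CR [measurable]: "C j \<in> measurable M (count_space UNIV)" if "j \<in> R" for j
      using C r that by auto
    have CJ [measurable]: "C j \<in> measurable M (count_space UNIV)" if "j \<in> ?J" for j
      using C that by auto
    note C[OF r(1), measurable]
    have zJ: "0 \<le> z j" "z j \<le> 1" if "j \<in> ?J" for j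
      using insert.prems(2)[of j] that by auto
    have H [measurable]: "?H \<in> borel_measurable M"
      by measurable
    have H1: "0 \<le> ?H \<omega>" "?H \<omega> \<le> 1" for \<omega>
      using zJ by (auto intro!: mult_nonneg_nonneg prod_nonneg mult_le_one prod_le_1 power_le_one zero_le_power)
    define e where "e i = expectation (\<lambda>\<omega>. ?H \<omega> * of_bool (C r \<omega> = i))" for i
    define P where "P = ?p"
    \<comment> \<open>With \<open>z r\<close> replaced by \<open>t\<close>, both sides of the
      induction hypothesis are power series in \<open>t\<close>, with coefficients
      \<open>e i\<close> and \<open>P * poisson_prob (a r) i\<close>.\<close>
    have "e (k r) - P * poisson_prob (a r) (k r) = 0"
    proof (rule power_series_coeff_eq_0)
      fix t :: real assume t: "0 < t" "t < 1"
      have "0 \<le> ?H \<omega> * t ^ C r \<omega>" "?H \<omega> * t ^ C r \<omega> \<le> 1" for \<omega>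
        using t by (intro mult_nonneg_nonneg mult_le_one H1 zero_le_power power_le_one; simp)+
      then have "integrable M (\<lambda>\<omega>. ?H \<omega> * t ^ C r \<omega>)"
        by (intro integrable_const_bound[of _ 1] AE_I2) (simp_all only: real_norm_def abs_of_nonneg, measurable)
      then have "(\<lambda>i. expectation (\<lambda>\<omega>. ?H \<omega> * t ^ C r \<omega> * of_bool (C r \<omega> = i))) sums
          expectation (\<lambda>\<omega>. ?H \<omega> * t ^ C r \<omega>)"
        by (intro sums_expectation_nat_valued) auto
      also have "(\<lambda>i. expectation (\<lambda>\<omega>. ?H \<omega> * t ^ C r \<omega> * of_bool (C r \<omega> = i))) =
          (\<lambda>i. expectation (\<lambda>\<omega>. ?H \<omega> * of_bool (C r \<omega> = i)) * t ^ i)"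
      proof
        fix i
        have "expectation (\<lambda>\<omega>. ?H \<omega> * t ^ C r \<omega> * of_bool (C r \<omega> = i)) =
          expectation (\<lambda>\<omega>. ?H \<omega> * of_bool (C r \<omega> = i) * t ^ i)"
          by (intro Bochner_Integration.integral_cong) auto
        then show "expectation (\<lambda>\<omega>. ?H \<omega> * t ^ C r \<omega> * of_bool (C r \<omega> = i)) =
          expectation (\<lambda>\<omega>. ?H \<omega> * of_bool (C r \<omega> = i)) * t ^ i" by simp
      qed
      also have "expectation (\<lambda>\<omega>. ?H \<omega> * t ^ C r \<omega>) = ?p * exp (a r * (t - 1))"
      proof -
        let ?z = "z(r := t)"
        have eq: "(\<Prod>j\<in>J - R. ?z j ^ C j \<omega>) = t ^ C r \<omega> * (\<Prod>j\<in>?J. z j ^ C j \<omega>)" for \<omega>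
          unfolding JR(1) using JR(2,3) by (subst prod.insert) (auto intro!: prod.cong)
        have eq2: "(\<Prod>j\<in>J - R. exp (a j * (?z j - 1))) =
          exp (a r * (t - 1)) * (\<Prod>j\<in>?J. exp (a j * (z j - 1)))"
          unfolding JR(1) using JR(2,3) by (subst prod.insert) (auto intro!: prod.cong)
        have "0 \<le> ?z j \<and> ?z j \<le> 1" if "j \<in> J" for j
          using insert.prems(2)[OF that] t by auto
        from insert.IH[of ?z, OF r(3) this] show ?thesis
          unfolding eq eq2 by (simp only: mult_ac)
      qed
      finally have "(\<lambda>i. e i * t ^ i) sums (P * exp (a r * (t - 1)))"
        unfolding e_def P_def .
      from sums_diff[OF this sums_mult[OF sums_poisson_prob_power[of "a r" t], of P]]
      show "(\<lambda>i. (e i - P * poisson_prob (a r) i) * t ^ i) sums 0"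
        by (simp add: left_diff_distrib mult.assoc)
    qed
    then have "e (k r) = P * poisson_prob (a r) (k r)" by simp
    moreover have "e (k r) = expectation (\<lambda>\<omega>. (\<Prod>j\<in>insert r R. of_bool (C j \<omega> = k j)) * (\<Prod>j\<in>?J. z j ^ C j \<omega>))"
      unfolding e_def prod.insert[OF r(4,2)] by (simp only: mult_ac)
    moreover have "P * poisson_prob (a r) (k r) =
        (\<Prod>j\<in>insert r R. poisson_prob (a j) (k j)) * (\<Prod>j\<in>?J. exp (a j * (z j - 1)))"
      unfolding P_def prod.insert[OF r(4,2)] by (simp only: mult_ac)
    ultimately show ?case by (simp only:)
  qed
  from this[of J "\<lambda>_. 1"]
  have "expectation (\<lambda>\<omega>. \<Prod>j\<in>J. of_bool (C j \<omega> = k j)) = (\<Prod>j\<in>J. poisson_prob (a j) (k j))"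
    by simp
  moreover have "(\<Prod>j\<in>J. of_bool (C j \<omega> = k j)) = (of_bool (\<forall>j\<in>J. C j \<omega> = k j) :: real)" for \<omega>
    using J by (induction J rule: finite_induct) auto
  moreover have "Measurable.pred M (\<lambda>\<omega>. \<forall>j\<in>J. C j \<omega> = k j)"
    using J C by (intro pred_intros_finite) auto
  ultimately show ?thesis by (simp add: expectation_of_bool)
qed

text \<open>The singletons, the empty set and \<open>UNIV\<close> form an intersection-stable
  generator of the discrete sigma-algebra. An index with the set \<open>UNIV\<close> drops out of
  the event, which is why \<open>joint\<close> ranges over all subsets \<open>J\<close>.\<close>

lemma (in prob_space) indep_vars_of_joint_pmf:
  fixes C :: "'i \<Rightarrow> 'a \<Rightarrow> nat"
  assumes I: "finite I"
    and C: "\<And>j. j \<in> I \<Longrightarrow> C j \<in> measurable M (count_space UNIV)"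
    and joint: "\<And>J k. J \<subseteq> I \<Longrightarrow>
      prob {\<omega>\<in>space M. \<forall>j\<in>J. C j \<omega> = k j} = (\<Prod>j\<in>J. prob {\<omega>\<in>space M. C j \<omega> = k j})"
  shows "indep_vars (\<lambda>_. count_space UNIV) C I"
proof (cases "I = {}")
  case True
  then show ?thesis by (simp add: indep_vars_def indep_sets_def)
next
  case False
  define E :: "nat set set" where "E = {UNIV, {}} \<union> range (\<lambda>k. {k})"
  have "indep_vars (\<lambda>_. count_space UNIV) C I \<longleftrightarrow> (\<forall>A\<in>(\<Pi> i\<in>I. E).
      prob (\<Inter>j\<in>I. C j -` A j \<inter> space M) = (\<Prod>j\<in>I. prob (C j -` A j \<inter> space M)))"
  proof (rule indep_vars_finite[OF False I _ C])
    have "A \<in> sigma_sets UNIV E" for A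
    proof -
      have "(\<Union>k\<in>A. {k}) \<in> sigma_sets UNIV E"
        by (intro sigma_sets_UNION countable_image) (auto simp: E_def)
      then show ?thesis by simp
    qed
    then show "sets (count_space UNIV) = sigma_sets (space (count_space UNIV)) E" by auto
    show "Int_stable E" by (auto simp: Int_stable_def E_def)
  qed (auto simp: E_def)
  moreover have "prob (\<Inter>j\<in>I. C j -` A j \<inter> space M) = (\<Prod>j\<in>I. prob (C j -` A j \<inter> space M))"
    if A: "A \<in> (\<Pi> i\<in>I. E)" for A
  proof (cases "\<exists>j\<in>I. A j = {}")
    case True
    then have "(\<Inter>j\<in>I. C j -` A j \<inter> space M) = {}" by auto
    moreover have "(\<Prod>j\<in>I. prob (C j -` A j \<inter> space M)) = 0"
      using True I by (intro prod_zero) (auto intro!: bexI)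
    ultimately show ?thesis by simp
  next
    case ne: False
    define J where "J = {j\<in>I. A j \<noteq> UNIV}"
    define k where "k j = the_elem (A j)" for j
    have k: "A j = {k j}" if "j \<in> J" for j
      using A ne that by (auto simp: J_def k_def E_def Pi_iff)
    have U: "A j = UNIV" if "j \<in> I - J" for j using that by (auto simp: J_def)
    have "(\<Inter>j\<in>I. C j -` A j \<inter> space M) = {\<omega>\<in>space M. \<forall>j\<in>J. C j \<omega> = k j}"
    proof -
      have "C j \<omega> \<in> A j \<longleftrightarrow> (j \<in> J \<longrightarrow> C j \<omega> = k j)" if "j \<in> I" for j \<omega>
        using k[of j] U[of j] that by (cases "j \<in> J") auto
      moreover have "J \<subseteq> I" by (auto simp: J_def)
      ultimately show ?thesis using False by auto
    qed
    also have "prob \<dots> = (\<Prod>j\<in>J. prob {\<omega>\<in>space M. C j \<omega> = k j})"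
      by (rule joint) (auto simp: J_def)
    also have "\<dots> = (\<Prod>j\<in>J. prob (C j -` A j \<inter> space M))"
      by (intro prod.cong refl arg_cong[where f=prob]) (use k in auto)
    also have "\<dots> = (\<Prod>j\<in>I. prob (C j -` A j \<inter> space M))"
      by (intro prod.mono_neutral_left[OF I]) (auto simp: J_def prob_space)
    finally show ?thesis .
  qed
  ultimately show ?thesis by blast
qed

text \<open>On the event that the Poisson variable is \<open>k\<close>, independence turns the
  expected product into the \<open>k\<close>-th power of the mean of \<open>\<phi>\<close>; summing
  over \<open>k\<close> evaluates the Poisson generating function at this mean.\<close>

lemma (in prob_space) compound_poisson_pgf:
  assumes Y: "indep_vars (\<lambda>_. S) Y I" and q: "q \<in> I" "range p \<subseteq> I" "inj p" "q \<notin> range p"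
    and \<kappa> [measurable]: "\<kappa> \<in> measurable S (count_space UNIV)"
    and K: "\<And>k. prob {\<omega>\<in>space M. \<kappa> (Y q \<omega>) = k} = poisson_prob c k"
    and D: "\<And>i. distr M S (Y (p i)) = D"
    and \<phi> [measurable]: "\<phi> \<in> borel_measurable S" and \<phi>1: "\<And>y. 0 \<le> \<phi> y" "\<And>y. \<phi> y \<le> (1::real)"
  shows "expectation (\<lambda>\<omega>. \<Prod>i<\<kappa> (Y q \<omega>). \<phi> (Y (p i) \<omega>)) = exp (c * ((LINT y|D. \<phi> y) - 1))"
proof -
  have YS: "Y i \<in> measurable M S" if "i \<in> I" for i
    using Y that by (auto simp: indep_vars_def)
  note [measurable] = YS[OF q(1)]
  have [measurable]: "Y (p i) \<in> measurable M S" for i using q by (intro YS) auto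
  have E\<phi>: "expectation (\<lambda>\<omega>. \<phi> (Y (p i) \<omega>)) = (LINT y|D. \<phi> y)" for i
    by (subst D[of i, symmetric], subst integral_distr) auto
  let ?F = "\<lambda>\<omega>. \<Prod>i<\<kappa> (Y q \<omega>). \<phi> (Y (p i) \<omega>)"
  have F [measurable]: "?F \<in> borel_measurable M"
    by (rule measurable_compose_countable[where g="\<lambda>\<omega>. \<kappa> (Y q \<omega>)"]) measurable
  have F1: "0 \<le> ?F \<omega>" "?F \<omega> \<le> 1" for \<omega>
    using \<phi>1 by (auto intro!: prod_nonneg prod_le_1)
  have "integrable M ?F"
    using F1 by (intro integrable_const_bound[of _ 1]) auto
  then have "(\<lambda>k. expectation (\<lambda>\<omega>. ?F \<omega> * of_bool (\<kappa> (Y q \<omega>) = k))) sums expectation ?F"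
    by (intro sums_expectation_nat_valued) auto
  also have "(\<lambda>k. expectation (\<lambda>\<omega>. ?F \<omega> * of_bool (\<kappa> (Y q \<omega>) = k))) =
      (\<lambda>k. poisson_prob c k * (LINT y|D. \<phi> y) ^ k)"
  proof
    fix k
    let ?I = "insert q (p ` {..<k})"
    \<comment> \<open>The event that the Poisson variable equals \<open>k\<close> is treated as one
      more independent factor, sitting at the index \<open>q\<close>.\<close>
    let ?X = "\<lambda>i \<omega>. (if i = q then of_bool (\<kappa> (Y i \<omega>) = k) else \<phi> (Y i \<omega>)) :: real"
    have ind: "indep_vars (\<lambda>_. borel) ?X ?I"
      using q by (intro indep_vars_compose2[OF indep_vars_subset[OF Y]]) auto
    have split: "(\<Prod>i\<in>?I. f i) = f q * (\<Prod>i<k. f (p i))" for f :: "_ \<Rightarrow> real"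
      using q by (subst prod.insert) (auto simp: prod.reindex inj_on_subset[OF q(3)])
    have "expectation (\<lambda>\<omega>. ?F \<omega> * of_bool (\<kappa> (Y q \<omega>) = k)) = expectation (\<lambda>\<omega>. \<Prod>i\<in>?I. ?X i \<omega>)"
      unfolding split using q
      by (intro Bochner_Integration.integral_cong) (auto intro!: prod.cong)
    also have "\<dots> = (\<Prod>i\<in>?I. expectation (?X i))"
    proof (rule indep_vars_lebesgue_integral[OF _ ind])
      fix i assume "i \<in> ?I"
      then have "Y i \<in> measurable M S" using q by (auto intro!: YS)
      then show "integrable M (?X i)"
        using \<phi>1 by (intro integrable_const_bound[of _ 1]) auto
    qed simp
    also have "\<dots> = poisson_prob c k * (\<Prod>i<k. expectation (\<lambda>\<omega>. \<phi> (Y (p i) \<omega>)))"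
      unfolding split using q
      by (auto simp: expectation_of_bool K intro!: prod.cong Bochner_Integration.integral_cong)
    finally show "expectation (\<lambda>\<omega>. ?F \<omega> * of_bool (\<kappa> (Y q \<omega>) = k)) =
      poisson_prob c k * (LINT y|D. \<phi> y) ^ k" by (simp add: E\<phi>)
  qed
  finally show ?thesis
    using sums_poisson_prob_power[of c "LINT y|D. \<phi> y"] by (simp add: sums_unique2)
qed

lemma card_eq_sum_of_bool: "card {i. i < n \<and> P i} = (\<Sum>i<n. of_bool (P i))" for n :: nat
proof -
  have "{i. i < n \<and> P i} = {..<n} \<inter> {i. P i}" by auto
  then show ?thesis by (simp only: sum_of_bool_eq finite_lessThan of_nat_id)
qed

lemma measurable_card_random_bound:
  assumes [measurable]: "K \<in> measurable M (count_space (UNIV :: nat set))"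
    and [measurable]: "\<And>i. Measurable.pred M (P i)"
  shows "(\<lambda>\<omega>. card {i. i < K \<omega> \<and> P i \<omega>}) \<in> measurable M (count_space UNIV)"
  unfolding card_eq_sum_of_bool by (rule measurable_compose_countable[where g=K]) measurable

text \<open>Each point contributes the factor \<open>z j\<close> if it falls into
  \<open>A b j\<close>, and 1 if it falls into no set of the family. The two streams read disjoint
  sets of coordinates, so their generating functions multiply, and the exponents add up to those of
  independent Poisson counts with the summed rates.\<close>

lemma (in prob_space) superposed_poisson_joint:
  fixes Y :: "'i \<Rightarrow> 'a \<Rightarrow> 'b" and q :: "bool \<Rightarrow> 'i" and p :: "bool \<Rightarrow> nat \<Rightarrow> 'i"
    and A :: "bool \<Rightarrow> 'j \<Rightarrow> 'b set"
  assumes Y: "indep_vars (\<lambda>_. S) Y UNIV"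
    and p: "\<And>b. inj (p b)" "range (p False) \<inter> range (p True) = {}"
    and q: "\<And>b b'. q b \<notin> range (p b')" "q False \<noteq> q True"
    and \<kappa> [measurable]: "\<kappa> \<in> measurable S (count_space UNIV)"
    and K: "\<And>b k. prob {\<omega>\<in>space M. \<kappa> (Y (q b) \<omega>) = k} = poisson_prob (c b) k"
    and D: "\<And>b i. distr M S (Y (p b i)) = D b"
    and J: "finite J" and A: "\<And>b j. j \<in> J \<Longrightarrow> A b j \<in> sets S"
    and disj: "\<And>b. disjoint_family_on (A b) J"
  shows "prob {\<omega>\<in>space M. \<forall>j\<in>J.
      (\<Sum>b\<in>UNIV. card {i. i < \<kappa> (Y (q b) \<omega>) \<and> Y (p b i) \<omega> \<in> A b j}) = k j} =
    (\<Prod>j\<in>J. poisson_prob (\<Sum>b\<in>UNIV. c b * measure (D b) (A b j)) (k j))"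
proof (rule joint_poisson_of_pgf[OF J])
  have [measurable]: "Y i \<in> measurable M S" for i
    using Y by (auto simp: indep_vars_def)
  let ?C = "\<lambda>j \<omega>. \<Sum>b\<in>UNIV. card {i. i < \<kappa> (Y (q b) \<omega>) \<and> Y (p b i) \<omega> \<in> A b j}"
  show "?C j \<in> measurable M (count_space UNIV)" if j: "j \<in> J" for j
  proof -
    note A[OF j, measurable]
    have [measurable]: "(\<lambda>\<omega>. card {i. i < \<kappa> (Y (q b) \<omega>) \<and> Y (p b i) \<omega> \<in> A b j}) \<in> measurable M (count_space UNIV)" for b
      by (rule measurable_card_random_bound) measurable
    show ?thesis by measurable
  qed
  fix z :: "'j \<Rightarrow> real" assume z: "\<And>j. j \<in> J \<Longrightarrow> 0 \<le> z j \<and> z j \<le> 1"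
  define \<phi> where "\<phi> b y = (\<Prod>j\<in>J. if y \<in> A b j then z j else 1)" for b y
  have \<phi> [measurable]: "\<phi> b \<in> borel_measurable S" for b
    unfolding \<phi>_def using A by measurable
  have \<phi>1: "0 \<le> \<phi> b y" "\<phi> b y \<le> 1" for b y
    unfolding \<phi>_def using z by (auto intro!: prod_nonneg prod_le_1)
  \<comment> \<open>By disjointness at most one factor differs from 1, so the product is affine in
    the \<open>z j\<close> and can be integrated term by term.\<close>
  have \<phi>_sum: "\<phi> b y = 1 + (\<Sum>j\<in>J. (z j - 1) * indicator (A b j) y)" for b y
  proof (cases "\<exists>j\<in>J. y \<in> A b j")
    case True
    then obtain l where l: "l \<in> J" "y \<in> A b l" by auto
    have *: "y \<notin> A b j" if "j \<in> J" "j \<noteq> l" for j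
      using disj[of b] l that by (auto simp: disjoint_family_on_def)
    have "\<phi> b y = z l * (\<Prod>j\<in>J - {l}. if y \<in> A b j then z j else 1)"
      unfolding \<phi>_def using J l by (subst prod.remove[of _ l]) auto
    also have "(\<Prod>j\<in>J - {l}. if y \<in> A b j then z j else 1) = 1"
      using * by (intro prod.neutral) auto
    moreover have "(\<Sum>j\<in>J. (z j - 1) * indicator (A b j) y) =
        (z l - 1) + (\<Sum>j\<in>J - {l}. (z j - 1) * indicator (A b j) y)"
      using J l by (subst sum.remove[of _ l]) auto
    moreover have "(\<Sum>j\<in>J - {l}. (z j - 1) * indicator (A b j) y) = 0"
      using * by (intro sum.neutral) auto
    ultimately show ?thesis by simp
  qed (auto simp: \<phi>_def)
  have E\<phi>: "(LINT y|D b. \<phi> b y) = 1 + (\<Sum>j\<in>J. (z j - 1) * measure (D b) (A b j))" for b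
  proof -
    interpret D: prob_space "D b"
      unfolding D[of b 0, symmetric] by (rule prob_space_distr) measurable
    have S: "sets (D b) = sets S" "space (D b) = space S"
      by (simp_all flip: D[of b 0])
    have int: "integrable (D b) (\<lambda>y. (z j - 1) * indicator (A b j) y)" if "j \<in> J" for j
      using A[OF that, of b] by (intro integrable_mult_right) (auto simp: S D.emeasure_eq_measure)
    let ?f = "\<lambda>j y. (z j - 1) * indicator (A b j) y :: real"
    have "integral\<^sup>L (D b) (\<phi> b) = integral\<^sup>L (D b) (\<lambda>y. 1 + (\<Sum>j\<in>J. ?f j y))"
      by (rule Bochner_Integration.integral_cong[OF refl \<phi>_sum])
    also have "\<dots> = integral\<^sup>L (D b) (\<lambda>y. 1) + integral\<^sup>L (D b) (\<lambda>y. \<Sum>j\<in>J. ?f j y)"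
      by (intro Bochner_Integration.integral_add Bochner_Integration.integrable_sum int D.integrable_const)
    also have "integral\<^sup>L (D b) (\<lambda>y. \<Sum>j\<in>J. ?f j y) = (\<Sum>j\<in>J. integral\<^sup>L (D b) (?f j))"
      by (rule Bochner_Integration.integral_sum[OF int])
    also have "\<dots> = (\<Sum>j\<in>J. (z j - 1) * measure (D b) (A b j))"
    proof (rule sum.cong[OF refl])
      fix j assume "j \<in> J"
      then have "A b j \<inter> space (D b) = A b j"
        using A[of j b, THEN sets.sets_into_space] by (auto simp: S)
      then show "integral\<^sup>L (D b) (?f j) = (z j - 1) * measure (D b) (A b j)"
        by simp
    qed
    finally show ?thesis by (simp add: D.prob_space)
  qed
  define G where "G b \<omega> = (\<Prod>i<\<kappa> (Y (q b) \<omega>). \<phi> b (Y (p b i) \<omega>))" for b \<omega>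
  have G: "expectation (G b) = exp (c b * ((LINT y|D b. \<phi> b y) - 1))" for b
    unfolding G_def using q(1)
    by (intro compound_poisson_pgf[OF Y _ _ p(1) _ \<kappa> K D \<phi> \<phi>1]) auto
  have G_meas [measurable]: "G b \<in> borel_measurable M" for b
    unfolding G_def
    by (rule measurable_compose_countable[where g="\<lambda>\<omega>. \<kappa> (Y (q b) \<omega>)"]) measurable
  have G1: "0 \<le> G b \<omega>" "G b \<omega> \<le> 1" for b \<omega>
    unfolding G_def using \<phi>1 by (auto intro!: prod_nonneg prod_le_1)
  have G_int: "integrable M (G b)" for b
    using G1 by (intro integrable_const_bound[of _ 1]) auto
  have "indep_var borel (G False) borel (G True)"
  proof -
    \<comment> \<open>Each stream is a function of its own block \<open>I b\<close> of coordinates;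
      the blocks are disjoint, which gives independence.\<close>
    define I where "I b = insert (q b) (range (p b))" for b
    define g where "g b y = (\<Prod>i<\<kappa> (y (q b)). \<phi> b (y (p b i)))" for b y
    have gG: "G b = g b \<circ> (\<lambda>\<omega>. \<lambda>i\<in>I b. Y i \<omega>)" for b
      by (auto simp: G_def g_def I_def fun_eq_iff)
    have [measurable]: "(\<lambda>y. y (q b)) \<in> measurable (Pi\<^sub>M (I b) (\<lambda>_. S)) S"
        "(\<lambda>y. y (p b i)) \<in> measurable (Pi\<^sub>M (I b) (\<lambda>_. S)) S" for b i
      by (auto intro!: measurable_component_singleton simp: I_def)
    have "g b \<in> borel_measurable (Pi\<^sub>M (I b) (\<lambda>_. S))" for b
      unfolding g_def
      by (rule measurable_compose_countable[where g="\<lambda>y. \<kappa> (y (q b))"]) measurable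
    moreover have "I False \<inter> I True = {}"
      using p(2) q by (auto simp: I_def)
    ultimately show ?thesis
      unfolding gG by (intro indep_var_compose[OF indep_var_restrict[OF Y]]) auto
  qed
  note EG = indep_var_lebesgue_integral[OF this G_int G_int]
  have "(\<Prod>j\<in>J. z j ^ ?C j \<omega>) = G False \<omega> * G True \<omega>" for \<omega>
  proof -
    have "(\<Prod>j\<in>J. z j ^ (\<Sum>i<n. of_bool (Y (p b i) \<omega> \<in> A b j))) = (\<Prod>i<n. \<phi> b (Y (p b i) \<omega>))" for n b
      unfolding \<phi>_def power_sum
      by (subst prod.swap) (auto intro!: prod.cong)
    then show ?thesis
      by (simp add: card_eq_sum_of_bool G_def UNIV_bool power_add prod.distrib)
  qed
  then have "expectation (\<lambda>\<omega>. \<Prod>j\<in>J. z j ^ ?C j \<omega>) = expectation (G False) * expectation (G True)"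
    using EG by simp
  also have "\<dots> = exp (\<Sum>j\<in>J. (\<Sum>b\<in>UNIV. c b * measure (D b) (A b j)) * (z j - 1))"
  proof -
    have "c b * ((LINT y|D b. \<phi> b y) - 1) = (\<Sum>j\<in>J. c b * measure (D b) (A b j) * (z j - 1))" for b
      unfolding E\<phi> add_diff_cancel_left' sum_distrib_left by (intro sum.cong refl) (simp only: mult_ac)
    then show ?thesis
      unfolding G exp_add[symmetric]
      by (simp only: UNIV_bool sum.distrib distrib_right sum.insert sum.empty finite_insert
          finite.emptyI empty_iff insert_iff bool.simps simp_thms add_0_right)
  qed
  also have "\<dots> = (\<Prod>j\<in>J. exp ((\<Sum>b\<in>UNIV. c b * measure (D b) (A b j)) * (z j - 1)))"
    using J by (rule exp_sum)
  finally show "expectation (\<lambda>\<omega>. \<Prod>j\<in>J. z j ^ ?C j \<omega>) =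
    (\<Prod>j\<in>J. exp ((\<Sum>b\<in>UNIV. c b * measure (D b) (A b j)) * (z j - 1)))" .
qed

section \<open>Point processes built from marked points\<close>

lemma pred_eq_borel_vec:
  assumes X: "X \<in> measurable M (borel_vec n)" and Y: "Y \<in> measurable M (borel_vec n)"
  shows "Measurable.pred M (\<lambda>\<omega>. X \<omega> = Y \<omega>)"
proof -
  have [measurable]: "(\<lambda>\<omega>. X \<omega> $ i) \<in> borel_measurable M" "(\<lambda>\<omega>. Y \<omega> $ i) \<in> borel_measurable M" if "i < n" for i
    using that by (auto intro: measurable_compose[OF X] measurable_compose[OF Y])
  have "Measurable.pred M (\<lambda>\<omega>. \<forall>i\<in>{..<n}. X \<omega> $ i = Y \<omega> $ i)"
    by (intro pred_intros_finite) auto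
  moreover have "X \<omega> = Y \<omega> \<longleftrightarrow> (\<forall>i\<in>{..<n}. X \<omega> $ i = Y \<omega> $ i)" if "\<omega> \<in> space M" for \<omega>
    using X[THEN measurable_space, OF that] Y[THEN measurable_space, OF that]
    by (auto intro!: eq_vecI)
  ultimately show ?thesis
    by (simp cong: measurable_cong)
qed

lemma sets_borel_vec_singleton:
  assumes "x \<in> carrier_vec n"
  shows "{x} \<in> sets (borel_vec n)"
proof -
  have "Measurable.pred (borel_vec n) (\<lambda>z. z = x)"
    using assms by (intro pred_eq_borel_vec[of _ _ n]) auto
  then have "{z \<in> space (borel_vec n). z = x} \<in> sets (borel_vec n)" by measurable
  moreover have "{z \<in> space (borel_vec n). z = x} = {x}" using assms by auto
  ultimately show ?thesis by simp
qed

section \<open>Counting measures of finite configurations\<close>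

lemma card_vimage_eq_sum:
  assumes "finite I" "finite S" "p ` I \<subseteq> S"
  shows "card {i\<in>I. p i \<in> E} = (\<Sum>x\<in>S \<inter> E. card {i\<in>I. p i = x})"
proof -
  have "{i\<in>I. p i \<in> E} = (\<Union>x\<in>S \<inter> E. {i\<in>I. p i = x})"
    using assms by auto
  then show ?thesis
    using assms by (simp only:) (subst card_UN_disjoint, auto)
qed

text \<open>Two finite point configurations induce the same counting measure iff they have the same
  multiplicities at their own points, which is a countable condition.\<close>

lemma counts_eq_iff:
  fixes pt :: "bool \<Rightarrow> nat \<Rightarrow> real vec" and K :: "bool \<Rightarrow> nat"
  assumes B: "B \<subseteq> carrier_vec n"
  shows "(\<forall>E\<in>sets (borel_vec n). E \<subseteq> B \<longrightarrow> card {i. i < N \<and> pt False i \<in> E} =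
      (\<Sum>b\<in>UNIV. card {i. i < K b \<and> act b i \<and> pt b i \<in> E})) \<longleftrightarrow>
    (\<forall>d m. pt d m \<in> B \<longrightarrow> card {i. i < N \<and> pt False i = pt d m} =
      (\<Sum>b\<in>UNIV. card {i. i < K b \<and> act b i \<and> pt b i = pt d m}))"
    (is "?L \<longleftrightarrow> ?R")
proof
  assume L: ?L
  show ?R
  proof (intro allI impI)
    fix d m assume "pt d m \<in> B"
    then show "card {i. i < N \<and> pt False i = pt d m} =
      (\<Sum>b\<in>UNIV. card {i. i < K b \<and> act b i \<and> pt b i = pt d m})"
      using L[rule_format, of "{pt d m}"] B sets_borel_vec_singleton[of "pt d m" n] by auto
  qed
next
  assume R: ?R
  \<comment> \<open>A location that is none of the points \<open>pt d m\<close> has multiplicity 0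
    on both sides, so the condition at the points extends to all of \<open>B\<close>.\<close>
  have R': "card {i. i < N \<and> pt False i = x} = (\<Sum>b\<in>UNIV. card {i. i < K b \<and> act b i \<and> pt b i = x})"
    if "x \<in> B" for x
  proof (cases "\<exists>d m. x = pt d m")
    case True
    then show ?thesis using R that by auto
  next
    case False
    then have "pt d m \<noteq> x" for d m by metis
    then show ?thesis by simp
  qed
  show ?L
  proof (intro ballI impI)
    fix E assume "E \<in> sets (borel_vec n)" "E \<subseteq> B"
    define S where "S = pt False ` {..<N} \<union> (\<Union>b. pt b ` {..<K b})"
    have S: "finite S" by (simp add: S_def)
    have 1: "card {i. i < N \<and> pt False i \<in> E} = (\<Sum>x\<in>S \<inter> E. card {i. i < N \<and> pt False i = x})"
      using card_vimage_eq_sum[of "{..<N}" S "pt False" E] S by (auto simp: S_def)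
    have 2: "card {i. i < K b \<and> act b i \<and> pt b i \<in> E} =
        (\<Sum>x\<in>S \<inter> E. card {i. i < K b \<and> act b i \<and> pt b i = x})" for b
      using card_vimage_eq_sum[of "{i. i < K b \<and> act b i}" S "pt b" E] S by (auto simp: S_def conj_assoc)
    show "card {i. i < N \<and> pt False i \<in> E} = (\<Sum>b\<in>UNIV. card {i. i < K b \<and> act b i \<and> pt b i \<in> E})"
      unfolding 1 2 using R' \<open>E \<subseteq> B\<close> by (subst sum.swap) (auto intro!: sum.cong)
  qed
qed

text \<open>For a finite intensity everything probabilistic follows from the joint law of the counts
  on disjoint sets: \<open>J = {0}\<close> gives the law of a single count, and comparing the joint
  law with the single ones gives independence.\<close>

lemma (in prob_space) poisson_point_processI:
  fixes C :: "'b set \<Rightarrow> 'a \<Rightarrow> nat"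
  assumes fin: "\<And>E. E \<in> sets \<Lambda> \<Longrightarrow> emeasure \<Lambda> E < \<infinity>"
    and sets: "\<And>\<omega>. \<omega> \<in> space M \<Longrightarrow> sets (\<nu> \<omega>) = sets \<Lambda>"
    and \<nu>: "\<And>\<omega> E. \<omega> \<in> space M \<Longrightarrow> E \<in> sets \<Lambda> \<Longrightarrow> emeasure (\<nu> \<omega>) E = of_nat (C E \<omega>)"
    and C: "\<And>E. E \<in> sets \<Lambda> \<Longrightarrow> C E \<in> measurable M (count_space UNIV)"
    and joint: "\<And>J (F :: nat \<Rightarrow> 'b set) k. finite J \<Longrightarrow> F ` J \<subseteq> sets \<Lambda> \<Longrightarrow> disjoint_family_on F J \<Longrightarrow>
      prob {\<omega>\<in>space M. \<forall>j\<in>J. C (F j) \<omega> = k j} = (\<Prod>j\<in>J. poisson_prob (measure \<Lambda> (F j)) (k j))"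
  shows "poisson_point_process M \<Lambda> \<nu>"
proof -
  have meas: "(\<lambda>\<omega>. emeasure (\<nu> \<omega>) E) \<in> borel_measurable M" if E: "E \<in> sets \<Lambda>" for E
  proof -
    have "(\<lambda>\<omega>. of_nat (C E \<omega>) :: ennreal) \<in> borel_measurable M"
      using C[OF E] by measurable
    then show ?thesis
      by (rule measurable_cong[THEN iffD2, rotated]) (simp add: \<nu> E)
  qed
  have single: "prob {\<omega>\<in>space M. C E \<omega> = k} = poisson_prob (measure \<Lambda> E) k" if "E \<in> sets \<Lambda>" for E k
    using joint[of "{0}" "\<lambda>_. E" "\<lambda>_. k"] that by (simp add: disjoint_family_on_def)
  have law: "prob {\<omega>\<in>space M. emeasure (\<nu> \<omega>) E = of_nat k} =
      exp (- measure \<Lambda> E) * measure \<Lambda> E ^ k / fact k" if E: "E \<in> sets \<Lambda>" for E k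
  proof -
    have "{\<omega>\<in>space M. emeasure (\<nu> \<omega>) E = of_nat k} = {\<omega>\<in>space M. C E \<omega> = k}"
      using \<nu>[OF _ E] by auto
    then show ?thesis using single[OF E] by (simp add: poisson_prob_def)
  qed
  have indep: "indep_vars (\<lambda>_. borel) (\<lambda>j \<omega>. emeasure (\<nu> \<omega>) (F j)) {..<m}"
    if F: "F ` {..<m} \<subseteq> sets \<Lambda>" "disjoint_family_on F {..<m}" for m and F :: "nat \<Rightarrow> 'b set"
  proof -
    have "indep_vars (\<lambda>_. count_space UNIV) (\<lambda>j. C (F j)) {..<m}"
    proof (rule indep_vars_of_joint_pmf)
      fix J k assume J: "J \<subseteq> {..<m}"
      have "disjoint_family_on F J" using F(2) J by (auto simp: disjoint_family_on_def)
      then have "prob {\<omega>\<in>space M. \<forall>j\<in>J. C (F j) \<omega> = k j} = (\<Prod>j\<in>J. poisson_prob (measure \<Lambda> (F j)) (k j))"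
        using F(1) J finite_subset[OF J] by (intro joint) auto
      also have "\<dots> = (\<Prod>j\<in>J. prob {\<omega>\<in>space M. C (F j) \<omega> = k j})"
        using F(1) J by (intro prod.cong refl single[symmetric]) auto
      finally show "prob {\<omega>\<in>space M. \<forall>j\<in>J. C (F j) \<omega> = k j} =
        (\<Prod>j\<in>J. prob {\<omega>\<in>space M. C (F j) \<omega> = k j})" .
    qed (use F C in auto)
    then have "indep_vars (\<lambda>_. borel) (\<lambda>j \<omega>. of_nat (C (F j) \<omega>) :: ennreal) {..<m}"
      by (rule indep_vars_compose2) auto
    \<comment> \<open>\<open>\<nu>\<close> and \<open>C\<close> agree on \<open>space M\<close>
      only, so independence is transferred through preimages inside \<open>space M\<close>.\<close>
    moreover have "sigma_sets (space M) {(\<lambda>\<omega>. emeasure (\<nu> \<omega>) (F j)) -` A \<inter> space M |A. A \<in> sets borel} =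
      sigma_sets (space M) {(\<lambda>\<omega>. of_nat (C (F j) \<omega>) :: ennreal) -` A \<inter> space M |A. A \<in> sets borel}"
      if "j < m" for j
    proof -
      have "(\<lambda>\<omega>. emeasure (\<nu> \<omega>) (F j)) -` A \<inter> space M = (\<lambda>\<omega>. of_nat (C (F j) \<omega>)) -` A \<inter> space M" for A
        using \<nu>[of _ "F j"] F(1) that by auto
      then show ?thesis by simp
    qed
    then have "indep_sets (\<lambda>j. sigma_sets (space M) {(\<lambda>\<omega>. emeasure (\<nu> \<omega>) (F j)) -` A \<inter> space M |A. A \<in> sets borel}) {..<m} \<longleftrightarrow>
        indep_sets (\<lambda>j. sigma_sets (space M) {(\<lambda>\<omega>. of_nat (C (F j) \<omega>) :: ennreal) -` A \<inter> space M |A. A \<in> sets borel}) {..<m}"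
      by (intro indep_sets_cong) auto
    ultimately show ?thesis
      unfolding indep_vars_def using meas F(1) by auto
  qed
  show ?thesis
    unfolding poisson_point_process_def random_counting_measure_def
    using sets \<nu> meas law indep fin by (auto simp: less_top)
qed

text \<open>The identity \<open>shift\<close> yields the factorial moments \<open>a\<close> and
  \<open>a * a\<close>, and the square is (k - a)^2 = k (k - 1) + (1 - 2 a) k + a^2.\<close>

lemma sums_poisson_prob_variance:
  "(\<lambda>k. poisson_prob a k * (real k - a)\<^sup>2) sums a"
proof -
  have 0: "poisson_prob a sums 1"
    using sums_poisson_prob_power[of a 1] by simp
  have shift: "poisson_prob a (Suc k) * real (Suc k) = a * poisson_prob a k" for k
    by (simp add: poisson_prob_def del: of_nat_Suc)
  have "(\<lambda>k. poisson_prob a (Suc k) * real (Suc k)) sums (a * 1)"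
    unfolding shift by (rule sums_mult[OF 0])
  then have 1: "(\<lambda>k. poisson_prob a k * real k) sums a"
    by (subst (asm) sums_Suc_iff) simp
  have "(\<lambda>k. poisson_prob a (Suc k) * (real (Suc k) * real k)) sums (a * a)"
    using sums_mult[OF 1, of a] by (simp only: mult.assoc[symmetric] shift)
  then have 2: "(\<lambda>k. poisson_prob a k * (real k * (real k - 1))) sums (a * a)"
    using sums_Suc_iff[of "\<lambda>k. poisson_prob a k * (real k * (real k - 1))"] by simp
  have "(\<lambda>k. poisson_prob a k * (real k * (real k - 1)) + (1 - 2 * a) * (poisson_prob a k * real k) +
      a\<^sup>2 * poisson_prob a k) sums (a * a + (1 - 2 * a) * a + a\<^sup>2 * 1)"
    by (intro sums_add sums_mult 0 1 2)
  then show ?thesis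
    by (simp add: power2_eq_square algebra_simps)
qed

section \<open>Marks and Poisson numbers encoded as vectors\<close>

definition marked_law :: "nat \<Rightarrow> real vec measure \<Rightarrow> real vec measure" where
  "marked_law n \<mu> = distr (\<mu> \<Otimes>\<^sub>M uniform_measure lborel {0..1::real}) (borel_vec (Suc n)) (\<lambda>(x, u). vCons u x)"

text \<open>Poisson numbers are stored as constant vectors of the same dimension as marked points,
  so that all coordinates of the sample space live in the one measurable space
  \<open>borel_vec (Suc n)\<close>; \<open>count_vec\<close> reads the number back from entry
  0.\<close>

definition poisson_law :: "nat \<Rightarrow> real \<Rightarrow> real vec measure" where
  "poisson_law n c = distr (measure_pmf (poisson_pmf c)) (borel_vec (Suc n)) (\<lambda>k. vec (Suc n) (\<lambda>_. real k))"

definition pos_vec :: "nat \<Rightarrow> real vec \<Rightarrow> real vec" where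
  "pos_vec n v = vec n (\<lambda>i. v $ Suc i)"

definition count_vec :: "real vec \<Rightarrow> nat" where
  "count_vec v = nat \<lfloor>v $ 0\<rfloor>"

lemma measurable_pos_vec [measurable]: "pos_vec n \<in> measurable (borel_vec (Suc n)) (borel_vec n)"
  unfolding pos_vec_def by (rule measurable_borel_vecI) auto

lemma pos_vec_vCons [simp]: "x \<in> carrier_vec n \<Longrightarrow> pos_vec n (vCons u x) = x"
  by (intro eq_vecI) (auto simp: pos_vec_def)

lemma measurable_mark [measurable]: "(\<lambda>v. v $ 0) \<in> borel_measurable (borel_vec (Suc n))"
  by (rule measurable_vec_index) simp

lemma measurable_count_vec [measurable]: "count_vec \<in> measurable (borel_vec (Suc n)) (count_space UNIV)"
  unfolding count_vec_def by measurable

lemma measurable_vCons: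
  assumes "sets \<mu> = sets (borel_vec n)"
  shows "(\<lambda>(x, u). vCons u x) \<in> measurable (\<mu> \<Otimes>\<^sub>M uniform_measure lborel {0..1::real}) (borel_vec (Suc n))"
proof (rule measurable_borel_vecI)
  have sp: "space \<mu> = carrier_vec n" using sets_eq_imp_space_eq[OF assms] by simp
  show "(case \<omega> of (x, u) \<Rightarrow> vCons u x) \<in> carrier_vec (Suc n)"
    if "\<omega> \<in> space (\<mu> \<Otimes>\<^sub>M uniform_measure lborel {0..1::real})" for \<omega>
    using that sp by (auto simp: space_pair_measure)
  fix i assume i: "i < Suc n"
  show "(\<lambda>\<omega>. (case \<omega> of (x, u) \<Rightarrow> vCons u x) $ i) \<in> borel_measurable (\<mu> \<Otimes>\<^sub>M uniform_measure lborel {0..1})"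
  proof (cases i)
    case 0
    then show ?thesis by (simp add: case_prod_beta)
  next
    case (Suc j)
    have "measurable \<mu> borel = measurable (borel_vec n) (borel :: real measure)"
      by (rule measurable_cong_sets[OF assms refl])
    then have "(\<lambda>x. x $ j) \<in> borel_measurable \<mu>"
      using i Suc measurable_vec_index[of j n] by simp
    then show ?thesis using Suc by (simp add: case_prod_beta)
  qed
qed

lemma prob_space_uniform01: "prob_space (uniform_measure lborel {0..1::real})"
  by (rule prob_space_uniform_measure) auto

lemma prob_space_marked_law:
  assumes "prob_space \<mu>" "sets \<mu> = sets (borel_vec n)"
  shows "prob_space (marked_law n \<mu>)"
proof -
  interpret \<mu>: prob_space \<mu> by fact
  interpret U: prob_space "uniform_measure lborel {0..1::real}" by (rule prob_space_uniform01)
  interpret pair_prob_space \<mu> "uniform_measure lborel {0..1::real}" ..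
  show ?thesis
    unfolding marked_law_def by (rule prob_space_distr) (rule measurable_vCons[OF assms(2)])
qed

lemma sets_marked_law [simp]: "sets (marked_law n \<mu>) = sets (borel_vec (Suc n))"
  by (simp add: marked_law_def)

lemma sets_poisson_law [simp]: "sets (poisson_law n c) = sets (borel_vec (Suc n))"
  by (simp add: poisson_law_def)

lemma measurable_vec_const: "(\<lambda>k. vec (Suc n) (\<lambda>_. real k)) \<in> measurable (measure_pmf p) (borel_vec (Suc n))"
  by (rule measurable_borel_vecI) auto

lemma prob_space_poisson_law: "prob_space (poisson_law n c)"
  unfolding poisson_law_def
  by (rule prob_space.prob_space_distr[OF measure_pmf.prob_space_axioms measurable_vec_const])

lemma measure_poisson_law_count:
  assumes "0 < c"
  shows "measure (poisson_law n c) {v\<in>carrier_vec (Suc n). count_vec v = k} = poisson_prob c k"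
proof -
  have "{v\<in>space (borel_vec (Suc n)). count_vec v = k} \<in> sets (borel_vec (Suc n))" by measurable
  then have "measure (poisson_law n c) {v\<in>carrier_vec (Suc n). count_vec v = k} =
      measure (measure_pmf (poisson_pmf c)) ((\<lambda>k. vec (Suc n) (\<lambda>_. real k)) -` {v\<in>carrier_vec (Suc n). count_vec v = k})"
    unfolding poisson_law_def by (subst measure_distr[OF measurable_vec_const]) auto
  also have "(\<lambda>k. vec (Suc n) (\<lambda>_. real k)) -` {v\<in>carrier_vec (Suc n). count_vec v = k} = {k}"
    by (auto simp: count_vec_def)
  finally show ?thesis using assms by (simp add: measure_pmf_single poisson_prob_def)
qed

lemma distr_pos_marked_law:
  assumes "sets \<mu> = sets (borel_vec n)"
  shows "distr (marked_law n \<mu>) (borel_vec n) (pos_vec n) = \<mu>"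
proof -
  interpret U: prob_space "uniform_measure lborel {0..1::real}" by (rule prob_space_uniform01)
  have sp: "space \<mu> = carrier_vec n" using sets_eq_imp_space_eq[OF assms] by simp
  have "distr (marked_law n \<mu>) (borel_vec n) (pos_vec n) =
      distr (\<mu> \<Otimes>\<^sub>M uniform_measure lborel {0..1::real}) (borel_vec n) (pos_vec n \<circ> (\<lambda>(x, u). vCons u x))"
    unfolding marked_law_def by (rule distr_distr[OF measurable_pos_vec measurable_vCons[OF assms]])
  also have "\<dots> = distr (\<mu> \<Otimes>\<^sub>M uniform_measure lborel {0..1::real}) \<mu> fst"
  proof (rule distr_cong[OF refl])
    fix z assume "z \<in> space (\<mu> \<Otimes>\<^sub>M uniform_measure lborel {0..1::real})"
    then show "(pos_vec n \<circ> (\<lambda>(x, u). vCons u x)) z = fst z"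
      using sp by (auto simp: space_pair_measure)
  qed (use assms in simp)
  also have "\<dots> = \<mu>" by (rule U.distr_pair_fst)
  finally show ?thesis .
qed

text \<open>The acceptance rule u \<le> a / b is written as a product, which covers
  \<open>b = 0\<close>. A negative \<open>a\<close> gives 0 on both sides since
  \<open>ennreal\<close> truncates; this is how a thinning towards g - N h produces its positive
  part.\<close>

lemma uniform01_threshold:
  assumes "0 \<le> b"
  shows "ennreal b * emeasure (uniform_measure lborel {0..1::real}) {u. u * b \<le> a} = ennreal (min a b)"
proof (cases "b = 0")
  case True
  then show ?thesis by (simp add: ennreal_neg min_def)
next
  case False
  with assms have b: "0 < b" by simp
  have "{0..1} \<inter> {u. u * b \<le> a} = {0..min 1 (a / b)}"
    using b by (auto simp: field_simps)
  then have "emeasure (uniform_measure lborel {0..1::real}) {u. u * b \<le> a} = emeasure lborel {0..min 1 (a / b)}"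
    by (subst emeasure_uniform_measure) (auto simp: divide_ennreal_def)
  also have "\<dots> = ennreal (min 1 (a / b))"
    by (cases "0 \<le> min 1 (a / b)") (auto simp: ennreal_neg)
  also have "ennreal b * \<dots> = ennreal (b * min 1 (a / b))"
    using b by (simp add: ennreal_mult')
  also have "b * min 1 (a / b) = min a b"
    using b by (auto simp: min_def field_simps)
  finally show ?thesis .
qed

text \<open>Thinning by the marks: a point whose location has density \<open>w\<close> is retained when its uniform
  mark is at most \<open>a / (s * w)\<close>, which lowers the intensity \<open>s * w\<close> to \<open>min a (s * w)\<close>.\<close>

lemma emeasure_marked_law_thinned:
  assumes \<mu>: "prob_space \<mu>" "sets \<mu> = sets (borel_vec n)"
    and Z [measurable]: "Z \<in> measurable (borel_vec n) (borel_vec n)"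
    and law: "distr \<mu> (borel_vec n) Z = density (lborel_vec n) (\<lambda>x. ennreal (w x))"
    and w [measurable]: "w \<in> borel_measurable (borel_vec n)" and w0: "\<And>x. x \<in> carrier_vec n \<Longrightarrow> 0 \<le> w x"
    and a [measurable]: "a \<in> borel_measurable (borel_vec n)"
    and s: "0 \<le> s" and F [measurable]: "F \<in> sets (borel_vec n)"
  shows "ennreal s * emeasure (marked_law n \<mu>)
      {v\<in>carrier_vec (Suc n). Z (pos_vec n v) \<in> F \<and> v $ 0 * (s * w (Z (pos_vec n v))) \<le> a (Z (pos_vec n v))} =
    (\<integral>\<^sup>+x\<in>F. ennreal (min (a x) (s * w x)) \<partial>lborel_vec n)"
proof -
  let ?U = "uniform_measure lborel {0..1::real}"
  let ?A = "{v\<in>carrier_vec (Suc n). Z (pos_vec n v) \<in> F \<and> v $ 0 * (s * w (Z (pos_vec n v))) \<le> a (Z (pos_vec n v))}"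
  interpret \<mu>: prob_space \<mu> by fact
  interpret U: prob_space ?U by (rule prob_space_uniform01)
  have sp: "space \<mu> = carrier_vec n" using sets_eq_imp_space_eq[OF \<mu>(2)] by simp
  have [measurable]: "Z \<in> measurable \<mu> (borel_vec n)"
    using Z by (simp only: measurable_cong_sets[OF \<mu>(2) refl])
  have "{v\<in>space (borel_vec (Suc n)). Z (pos_vec n v) \<in> F \<and> v $ 0 * (s * w (Z (pos_vec n v))) \<le> a (Z (pos_vec n v))} \<in> sets (borel_vec (Suc n))"
    by measurable
  then have A: "?A \<in> sets (borel_vec (Suc n))" by simp
  \<comment> \<open>The probability that a point located at \<open>z\<close> is retained; Fubini
    integrates out the mark first.\<close>
  define q where "q z = emeasure ?U {u. u * (s * w z) \<le> a z}" for z
  have q [measurable]: "q \<in> borel_measurable (borel_vec n)"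
  proof -
    have "{zu\<in>space (borel_vec n \<Otimes>\<^sub>M ?U). snd zu * (s * w (fst zu)) \<le> a (fst zu)} \<in> sets (borel_vec n \<Otimes>\<^sub>M ?U)"
      by measurable
    from U.measurable_emeasure_Pair[OF this] show ?thesis
      by (rule measurable_cong[THEN iffD1, rotated]) (auto simp: q_def space_pair_measure intro!: arg_cong[where f="emeasure _"])
  qed
  let ?B = "(\<lambda>(x, u). vCons u x) -` ?A \<inter> space (\<mu> \<Otimes>\<^sub>M ?U)"
  have "emeasure (marked_law n \<mu>) ?A = emeasure (\<mu> \<Otimes>\<^sub>M ?U) ?B"
    unfolding marked_law_def by (rule emeasure_distr[OF measurable_vCons[OF \<mu>(2)] A])
  also have "\<dots> = (\<integral>\<^sup>+x. emeasure ?U (Pair x -` ?B) \<partial>\<mu>)"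
    by (rule U.emeasure_pair_measure_alt) (rule measurable_sets[OF measurable_vCons[OF \<mu>(2)] A])
  also have "\<dots> = (\<integral>\<^sup>+x. indicator F (Z x) * q (Z x) \<partial>\<mu>)"
  proof (rule nn_integral_cong)
    fix x assume "x \<in> space \<mu>"
    then have x: "x \<in> carrier_vec n" using sp by simp
    have "Pair x -` ?B = (if Z x \<in> F then {u. u * (s * w (Z x)) \<le> a (Z x)} else {})"
      using x sp by (auto simp: space_pair_measure)
    then show "emeasure ?U (Pair x -` ?B) = indicator F (Z x) * q (Z x)"
      by (simp add: q_def)
  qed
  also have "\<dots> = (\<integral>\<^sup>+z. indicator F z * q z \<partial>distr \<mu> (borel_vec n) Z)"
    by (rule nn_integral_distr[symmetric]) measurable
  also have "\<dots> = (\<integral>\<^sup>+z. ennreal (w z) * (indicator F z * q z) \<partial>lborel_vec n)"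
    unfolding law by (rule nn_integral_density) auto
  finally have "ennreal s * emeasure (marked_law n \<mu>) ?A =
      (\<integral>\<^sup>+z. ennreal s * (ennreal (w z) * (indicator F z * q z)) \<partial>lborel_vec n)"
    by (simp add: nn_integral_cmult)
  also have "\<dots> = (\<integral>\<^sup>+x\<in>F. ennreal (min (a x) (s * w x)) \<partial>lborel_vec n)"
  proof (rule nn_integral_cong)
    fix z assume "z \<in> space (lborel_vec n)"
    then have "0 \<le> w z" using w0 by simp
    then have "ennreal (s * w z) * q z = ennreal (min (a z) (s * w z))"
      unfolding q_def using s by (intro uniform01_threshold) auto
    then show "ennreal s * (ennreal (w z) * (indicator F z * q z)) = ennreal (min (a z) (s * w z)) * indicator F z"
      using s \<open>0 \<le> w z\<close> by (cases "z \<in> F") (simp_all add: ennreal_mult mult_ac)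
  qed
  finally show ?thesis .
qed

text \<open>Serves to pass from the coordinates, numbered by codes of triples, to the sequence:
  along an injection distinct indices read distinct coordinates.\<close>

lemma (in prob_space) indep_vars_reindex_inj:
  assumes Y: "indep_vars (\<lambda>_. S) Y UNIV" and e: "inj e"
  shows "indep_vars (\<lambda>_. S) (\<lambda>i. Y (e i)) I"
  unfolding indep_vars_def2
proof
  show "\<forall>i\<in>I. random_variable S (Y (e i))"
    using Y by (auto simp: indep_vars_def2)
  have ind: "indep_sets (\<lambda>i. {Y i -` A \<inter> space M |A. A \<in> sets S}) UNIV"
    using Y by (simp add: indep_vars_def2)
  show "indep_sets (\<lambda>i. {Y (e i) -` A \<inter> space M |A. A \<in> sets S}) I"
  proof (rule indep_setsI)
    show "{Y (e i) -` A \<inter> space M |A. A \<in> sets S} \<subseteq> events" for i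
      using Y by (auto simp: indep_vars_def2 intro: measurable_sets)
    fix A J assume J: "J \<noteq> {}" "J \<subseteq> I" "finite J"
      and A: "\<forall>j\<in>J. A j \<in> {Y (e j) -` A \<inter> space M |A. A \<in> sets S}"
    have "prob (\<Inter>j\<in>e ` J. A (the_inv e j)) = (\<Prod>j\<in>e ` J. prob (A (the_inv e j)))"
      by (rule indep_setsD[OF ind]) (use J A in \<open>auto simp: the_inv_f_f[OF e]\<close>)
    then show "prob (\<Inter>j\<in>J. A j) = (\<Prod>j\<in>J. prob (A j))"
      using e by (simp add: prod.reindex inj_on_subset[OF e] the_inv_f_f)
  qed
qed

text \<open>The generating function at the complement of the indicator of \<open>A\<close> is the
  probability exp(- c D(A)) of finding no point in \<open>A\<close>, and 1 - exp(- x) \<le>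
  x.\<close>

lemma (in prob_space) prob_poisson_point_in_le:
  assumes Y: "indep_vars (\<lambda>_. S) Y UNIV" and p: "inj p" "q \<notin> range p"
    and \<kappa> [measurable]: "\<kappa> \<in> measurable S (count_space UNIV)"
    and K: "\<And>k. prob {\<omega>\<in>space M. \<kappa> (Y q \<omega>) = k} = poisson_prob c k"
    and D: "\<And>i. distr M S (Y (p i)) = D"
    and A [measurable]: "A \<in> sets S"
  shows "prob {\<omega>\<in>space M. \<exists>i<\<kappa> (Y q \<omega>). Y (p i) \<omega> \<in> A} \<le> c * measure D A"
proof -
  have [measurable]: "Y i \<in> measurable M S" for i
    using Y by (auto simp: indep_vars_def)
  interpret D: prob_space D
    unfolding D[of 0, symmetric] by (rule prob_space_distr) measurable
  have S: "sets D = sets S" by (simp flip: D[of 0])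
  let ?E = "\<lambda>\<omega>. \<exists>i<\<kappa> (Y q \<omega>). Y (p i) \<omega> \<in> A"
  have E [measurable]: "Measurable.pred M ?E"
    by (rule measurable_compose_countable[where g="\<lambda>\<omega>. \<kappa> (Y q \<omega>)"]) measurable
  have "(LINT y|D. 1 - indicator A y) = 1 - measure D A"
    using A S sets.sets_into_space[of A D]
    by (subst Bochner_Integration.integral_diff)
      (auto simp: D.prob_space D.emeasure_eq_measure Int_absorb2)
  then have "exp (c * (1 - measure D A - 1)) =
      expectation (\<lambda>\<omega>. \<Prod>i<\<kappa> (Y q \<omega>). 1 - indicator A (Y (p i) \<omega>))"
    using compound_poisson_pgf[OF Y _ _ p \<kappa> K D, of "\<lambda>y. 1 - indicator A y"]
    by (auto simp: indicator_def)
  also have "\<dots> = expectation (\<lambda>\<omega>. of_bool (\<not> ?E \<omega>))"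
    by (intro Bochner_Integration.integral_cong) (auto intro!: prod.neutral split: split_indicator)
  also have "\<dots> = prob {\<omega>\<in>space M. \<not> ?E \<omega>}"
    by (rule expectation_of_bool)
  also have "\<dots> = 1 - prob {\<omega>\<in>space M. ?E \<omega>}"
    using E by (subst prob_neg) auto
  finally show ?thesis
    using exp_ge_add_one_self[of "c * (1 - measure D A - 1)"] by (simp add: algebra_simps)
qed

text \<open>The expected number of points in \<open>H\<close> with index between \<open>N\<close> and the Poisson variable is
  \<open>E \<bar>K - N\<bar> * D H\<close>, and \<open>E \<bar>K - N\<bar>\<close> is at most the standard deviation \<open>sqrt N\<close>.\<close>

lemma (in prob_space) prob_point_between_le:
  assumes Y: "indep_vars (\<lambda>_. S) Y UNIV" and p: "q \<notin> range p"
    and \<kappa> [measurable]: "\<kappa> \<in> measurable S (count_space UNIV)"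
    and K: "\<And>k. prob {\<omega>\<in>space M. \<kappa> (Y q \<omega>) = k} = poisson_prob (real N) k"
    and D: "\<And>i. distr M S (Y (p i)) = D"
    and H [measurable]: "H \<in> sets S" and N: "0 < N"
  shows "prob {\<omega>\<in>space M. \<exists>i. min N (\<kappa> (Y q \<omega>)) \<le> i \<and> i < max N (\<kappa> (Y q \<omega>)) \<and> Y (p i) \<omega> \<in> H} \<le>
    sqrt N * measure D H"
proof -
  have [measurable]: "Y i \<in> measurable M S" for i
    using Y by (auto simp: indep_vars_def)
  let ?K = "\<lambda>\<omega>. \<kappa> (Y q \<omega>)"
  let ?E = "\<lambda>\<omega>. \<exists>i. min N (?K \<omega>) \<le> i \<and> i < max N (?K \<omega>) \<and> Y (p i) \<omega> \<in> H"
  have E [measurable]: "Measurable.pred M ?E"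
    by (rule measurable_compose_countable[where g="\<lambda>\<omega>. ?K \<omega>"]) measurable
  have pair: "prob {\<omega>\<in>space M. ?K \<omega> = k \<and> Y (p i) \<omega> \<in> H} = poisson_prob N k * measure D H" for k i
  proof -
    have qp: "q \<noteq> p i" using p by auto
    define A where "A j = (if j = q then {v\<in>space S. \<kappa> v = k} else H)" for j
    have "prob (\<Inter>j\<in>{q, p i}. Y j -` A j \<inter> space M) = (\<Prod>j\<in>{q, p i}. prob (Y j -` A j \<inter> space M))"
    proof (rule indep_varsD[OF Y])
      have "{v\<in>space S. \<kappa> v = k} \<in> sets S" by measurable
      then show "A j \<in> sets S" if "j \<in> {q, p i}" for j using H by (simp add: A_def)
    qed auto
    also have "(\<Inter>j\<in>{q, p i}. Y j -` A j \<inter> space M) = {\<omega>\<in>space M. ?K \<omega> = k \<and> Y (p i) \<omega> \<in> H}"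
      using qp measurable_space[of "Y q" M S] by (auto simp: A_def)
    also have "(\<Prod>j\<in>{q, p i}. prob (Y j -` A j \<inter> space M)) =
        prob (Y q -` A q \<inter> space M) * prob (Y (p i) -` A (p i) \<inter> space M)"
      using qp by simp
    also have "Y q -` A q \<inter> space M = {\<omega>\<in>space M. ?K \<omega> = k}"
      using measurable_space[of "Y q" M S] by (auto simp: A_def)
    also have "prob (Y (p i) -` A (p i) \<inter> space M) = measure D H"
      using qp by (simp add: A_def measure_distr flip: D[of i])
    finally show ?thesis by (simp add: K)
  qed
  \<comment> \<open>A quadratic majorant of the absolute deviation, by the inequality of arithmetic
    and geometric means; since the variance is \<open>N\<close>, its mean is exactly sqrt N.\<close>
  define r where "r k = (sqrt N + (real k - real N)\<^sup>2 / sqrt N) / 2" for k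
  have absr: "\<bar>real k - real N\<bar> \<le> r k" for k
  proof -
    have "0 \<le> (sqrt N - \<bar>real k - real N\<bar>)\<^sup>2" by simp
    then have "2 * sqrt N * \<bar>real k - real N\<bar> \<le> N + (real k - real N)\<^sup>2"
      by (simp add: power2_diff)
    then show ?thesis
      using N by (simp add: r_def field_simps power2_eq_square)
  qed
  have "(\<lambda>k. expectation (\<lambda>\<omega>. of_bool (?E \<omega>) * of_bool (?K \<omega> = k) :: real)) sums expectation (\<lambda>\<omega>. of_bool (?E \<omega>))"
    by (intro sums_expectation_nat_valued[where K="?K" and F="\<lambda>\<omega>. of_bool (?E \<omega>)"]
        integrable_const_bound[of _ 1]) auto
  moreover have "(\<lambda>k. measure D H * (sqrt N / 2 * poisson_prob N k + 1 / (2 * sqrt N) * (poisson_prob N k * (real k - real N)\<^sup>2)))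
      sums (measure D H * (sqrt N / 2 * 1 + 1 / (2 * sqrt N) * N))"
    using sums_poisson_prob_power[of "real N" 1]
    by (intro sums_mult sums_add sums_poisson_prob_variance) simp
  moreover have "expectation (\<lambda>\<omega>. of_bool (?E \<omega>) * of_bool (?K \<omega> = k)) \<le>
      measure D H * (sqrt N / 2 * poisson_prob N k + 1 / (2 * sqrt N) * (poisson_prob N k * (real k - real N)\<^sup>2))" for k
  proof -
    \<comment> \<open>Once the Poisson number is fixed at \<open>k\<close>, only these |k - N|
      indices are possible, and the union bound runs over them.\<close>
    let ?I = "{min N k..<max N k}"
    have [measurable]: "Measurable.pred M (\<lambda>\<omega>. ?K \<omega> = k \<and> Y (p i) \<omega> \<in> H)" for i
      by measurable
    have "expectation (\<lambda>\<omega>. of_bool (?E \<omega>) * of_bool (?K \<omega> = k)) = prob {\<omega>\<in>space M. ?E \<omega> \<and> ?K \<omega> = k}"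
      by (simp add: expectation_of_bool flip: of_bool_conj)
    also have "{\<omega>\<in>space M. ?E \<omega> \<and> ?K \<omega> = k} = (\<Union>i\<in>?I. {\<omega>\<in>space M. ?K \<omega> = k \<and> Y (p i) \<omega> \<in> H})"
      by auto
    also have "prob \<dots> \<le> (\<Sum>i\<in>?I. prob {\<omega>\<in>space M. ?K \<omega> = k \<and> Y (p i) \<omega> \<in> H})"
      by (rule finite_measure_subadditive_finite) auto
    also have "\<dots> = \<bar>real k - real N\<bar> * (poisson_prob N k * measure D H)"
      unfolding pair by (simp add: of_nat_diff min_def max_def)
    also have "\<dots> \<le> r k * (poisson_prob N k * measure D H)"
      by (intro mult_right_mono absr) (simp add: poisson_prob_def)
    finally show ?thesis by (simp add: r_def field_simps)
  qed
  ultimately have "expectation (\<lambda>\<omega>. of_bool (?E \<omega>)) \<le> measure D H * (sqrt N / 2 * 1 + 1 / (2 * sqrt N) * N)"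
    by (rule sums_le[rotated])
  also have "\<dots> = sqrt N * measure D H"
    using N by (simp add: field_simps flip: power2_eq_square)
  finally show ?thesis by (simp add: expectation_of_bool)
qed

section \<open>Balls and the mass that the limit density gives them\<close>

lemma dot_eq_sum: "x \<in> carrier_vec n \<Longrightarrow> (x :: real vec) \<bullet> x = (\<Sum>i<n. (x $ i)\<^sup>2)"
  by (simp add: scalar_prod_def power2_eq_square atLeast0LessThan)

lemma sets_ball_vec [measurable]: "ball_vec n R \<in> sets (borel_vec n)"
proof -
  have "{x\<in>space (borel_vec n). sqrt (\<Sum>i<n. (x $ i)\<^sup>2) < R} \<in> sets (borel_vec n)"
    by measurable
  moreover have "{x\<in>space (borel_vec n). sqrt (\<Sum>i<n. (x $ i)\<^sup>2) < R} = ball_vec n R"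
    by (auto simp: ball_vec_def dot_eq_sum)
  ultimately show ?thesis by simp
qed

lemma ball_vec_carrier: "ball_vec n R \<subseteq> carrier_vec n"
  by (auto simp: ball_vec_def)

lemma ball_vec_abs_le:
  assumes x: "x \<in> ball_vec n R" and i: "i < n"
  shows "\<bar>x $ i\<bar> \<le> R"
proof -
  have "(x $ i)\<^sup>2 \<le> (\<Sum>i<n. (x $ i)\<^sup>2)"
    using i by (intro member_le_sum) auto
  then have "sqrt ((x $ i)\<^sup>2) \<le> sqrt (x \<bullet> x)"
    using x by (intro real_sqrt_le_mono) (auto simp: ball_vec_def dot_eq_sum)
  then show ?thesis using x by (auto simp: ball_vec_def)
qed

lemma measurable_limit_density [measurable]:
  assumes "0 < n"
  shows "limit_density n \<in> borel_measurable (borel_vec n)"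
  unfolding limit_density_def using assms by measurable auto

lemma emeasure_ball_vec_finite: "emeasure (lborel_vec n) (ball_vec n R) < \<infinity>"
proof (cases "ball_vec n R = {}")
  case False
  then obtain x where x: "x \<in> ball_vec n R" by auto
  then have "0 \<le> sqrt (x \<bullet> x)" by (simp add: ball_vec_def dot_eq_sum[of x n] sum_nonneg)
  moreover have "sqrt (x \<bullet> x) < R" using x by (simp add: ball_vec_def)
  ultimately have R: "0 \<le> R" by linarith
  have "{x \<in> space (borel_vec n). \<forall>i\<in>{..<n}. - R \<le> x $ i \<and> x $ i \<le> R} \<in> sets (borel_vec n)"
    by measurable
  then have box: "{x \<in> carrier_vec n. \<forall>i<n. - R \<le> x $ i \<and> x $ i \<le> R} \<in> sets (lborel_vec n)"
    by (simp only: space_borel_vec sets_lborel_vec Ball_def lessThan_iff)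
  have "ball_vec n R \<subseteq> {x \<in> carrier_vec n. \<forall>i<n. - R \<le> x $ i \<and> x $ i \<le> R}"
  proof
    fix x assume "x \<in> ball_vec n R"
    then show "x \<in> {x \<in> carrier_vec n. \<forall>i<n. - R \<le> x $ i \<and> x $ i \<le> R}"
      using ball_vec_abs_le[of x n R] ball_vec_carrier[of n R] by (force simp: abs_le_iff)
  qed
  then have "emeasure (lborel_vec n) (ball_vec n R) \<le>
      emeasure (lborel_vec n) {x \<in> carrier_vec n. \<forall>i<n. - R \<le> x $ i \<and> x $ i \<le> R}"
    by (rule emeasure_mono) (rule box)
  also have "\<dots> < \<infinity>"
    using emeasure_lborel_vec_box[of n "\<lambda>_. - R" "\<lambda>_. R"] R by simp
  finally show ?thesis .
qed simp

lemma emeasure_ball_vec_pos: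
  assumes R: "0 < R" and n: "0 < n"
  shows "0 < emeasure (lborel_vec n) (ball_vec n R)"
proof -
  \<comment> \<open>With this side length the sum of the coordinates is at most R / 2, so the
    Euclidean norm is strictly below \<open>R\<close>.\<close>
  let ?a = "R / (2 * real n)"
  have a: "0 < ?a" using R n by simp
  have "{x \<in> carrier_vec n. \<forall>i<n. 0 \<le> x $ i \<and> x $ i \<le> ?a} \<subseteq> ball_vec n R"
  proof
    fix x :: "real vec" assume x: "x \<in> {x \<in> carrier_vec n. \<forall>i<n. 0 \<le> x $ i \<and> x $ i \<le> ?a}"
    have "sqrt (x \<bullet> x) = L2_set (\<lambda>i. x $ i) {..<n}"
      using x by (simp add: L2_set_def dot_eq_sum)
    also have "\<dots> \<le> (\<Sum>i<n. \<bar>x $ i\<bar>)" by (rule L2_set_le_sum_abs)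
    also have "\<dots> \<le> (\<Sum>i<n. ?a)" using x by (intro sum_mono) auto
    also have "\<dots> < R" using R n by simp
    finally show "x \<in> ball_vec n R" using x by (simp add: ball_vec_def)
  qed
  then have "emeasure (lborel_vec n) {x \<in> carrier_vec n. \<forall>i<n. 0 \<le> x $ i \<and> x $ i \<le> ?a} \<le>
      emeasure (lborel_vec n) (ball_vec n R)"
    by (rule emeasure_mono) simp
  moreover have "0 < emeasure (lborel_vec n) {x \<in> carrier_vec n. \<forall>i<n. 0 \<le> x $ i \<and> x $ i \<le> ?a}"
    using emeasure_lborel_vec_box[of n "\<lambda>_. 0" "\<lambda>_. ?a"] a by simp
  ultimately show ?thesis by (rule less_le_trans[rotated])
qed

lemma limit_density_pos: "0 < limit_density n x"
  by (simp add: limit_density_def)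

text \<open>In the ball the first coordinate is at least - R, and the quadratic term only lowers the
  exponent.\<close>

lemma limit_density_le:
  assumes "x \<in> ball_vec n R" "0 < n"
  shows "limit_density n x \<le> exp R"
proof -
  have "0 \<le> pi * (\<Sum>i=1..<n. (x $ i)\<^sup>2)"
    by (intro mult_nonneg_nonneg sum_nonneg) auto
  then show ?thesis
    using ball_vec_abs_le[OF assms] by (simp add: limit_density_def abs_le_iff)
qed

lemma nn_integral_limit_density_finite:
  assumes "0 < n"
  shows "(\<integral>\<^sup>+x\<in>ball_vec n R. ennreal (limit_density n x) \<partial>lborel_vec n) < \<infinity>"
proof -
  have "(\<integral>\<^sup>+x\<in>ball_vec n R. ennreal (limit_density n x) \<partial>lborel_vec n) \<le>
      (\<integral>\<^sup>+x. ennreal (exp R) * indicator (ball_vec n R) x \<partial>lborel_vec n)"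
    using limit_density_le[OF _ assms, of _ R]
    by (intro nn_integral_mono) (auto intro!: ennreal_leI split: split_indicator)
  also have "\<dots> = ennreal (exp R) * emeasure (lborel_vec n) (ball_vec n R)"
    by (rule nn_integral_cmult_indicator) simp
  also have "\<dots> < \<infinity>"
    using emeasure_ball_vec_finite[of n R] by (simp add: ennreal_mult_less_top)
  finally show ?thesis .
qed

text \<open>A positive function with integral 0 would make the ball a null set. Positivity is what
  permits normalising the limit density to a probability law.\<close>

lemma nn_integral_limit_density_pos:
  assumes "0 < R" "0 < n"
  shows "0 < (\<integral>\<^sup>+x\<in>ball_vec n R. ennreal (limit_density n x) \<partial>lborel_vec n)"
proof (rule ccontr)
  assume "\<not> 0 < (\<integral>\<^sup>+x\<in>ball_vec n R. ennreal (limit_density n x) \<partial>lborel_vec n)"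
  then have "(\<integral>\<^sup>+x\<in>ball_vec n R. ennreal (limit_density n x) \<partial>lborel_vec n) = 0" by simp
  then have "AE x in lborel_vec n. ennreal (limit_density n x) * indicator (ball_vec n R) x = 0"
    using assms by (subst (asm) nn_integral_0_iff_AE) auto
  then have "AE x in lborel_vec n. x \<notin> ball_vec n R"
    by eventually_elim (auto simp: ennreal_eq_0_iff simp flip: not_less split: split_indicator_asm intro: limit_density_pos)
  moreover have "{x\<in>space (lborel_vec n). \<not> x \<notin> ball_vec n R} = ball_vec n R"
    using ball_vec_carrier[of n R] by auto
  ultimately have "emeasure (lborel_vec n) (ball_vec n R) = 0"
    using AE_iff_measurable[of "ball_vec n R" "lborel_vec n" "\<lambda>x. x \<notin> ball_vec n R"] by simp
  then show False using emeasure_ball_vec_pos[OF assms] by simp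
qed

lemma set_integral_limit_density:
  assumes "0 < n"
  shows "(LINT x:ball_vec n R|lborel_vec n. limit_density n x) =
    enn2real (\<integral>\<^sup>+x\<in>ball_vec n R. ennreal (limit_density n x) \<partial>lborel_vec n)"
  unfolding set_lebesgue_integral_def
  by (subst integral_eq_nn_integral)
    (use assms limit_density_pos[THEN less_imp_le] in
      \<open>auto intro!: arg_cong[where f=enn2real] nn_integral_cong split: split_indicator\<close>)

section \<open>The coupling\<close>

lemma sum_indicator_eq_card:
  "finite S \<Longrightarrow> (\<Sum>i\<in>S. indicator E (f i) :: ennreal) = of_nat (card {i\<in>S. f i \<in> E})"
  by (simp add: indicator_def sum.If_cases of_bool_def Int_def)

text \<open>The radius \<open>Suc \<rho>\<close> is positive for every \<open>\<rho>\<close>, and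
  countably many such balls exhaust the space.\<close>

definition ball_mass :: "nat \<Rightarrow> nat \<Rightarrow> real" where
  "ball_mass n \<rho> = enn2real (\<integral>\<^sup>+x\<in>ball_vec n (real (Suc \<rho>)). ennreal (limit_density n x) \<partial>lborel_vec n)"

definition ball_density :: "nat \<Rightarrow> nat \<Rightarrow> real vec \<Rightarrow> real" where
  "ball_density n \<rho> x = indicator (ball_vec n (real (Suc \<rho>))) x * limit_density n x / ball_mass n \<rho>"

definition ball_law :: "nat \<Rightarrow> nat \<Rightarrow> real vec measure" where
  "ball_law n \<rho> = density (lborel_vec n) (\<lambda>x. ennreal (ball_density n \<rho> x))"

lemma ball_mass_pos: "0 < n \<Longrightarrow> 0 < ball_mass n \<rho>"
  unfolding ball_mass_def
  using nn_integral_limit_density_pos[of "real (Suc \<rho>)" n] nn_integral_limit_density_finite[of n "real (Suc \<rho>)"]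
  by (subst enn2real_positive_iff) auto

lemma ennreal_ball_mass:
  "0 < n \<Longrightarrow> ennreal (ball_mass n \<rho>) =
    (\<integral>\<^sup>+x\<in>ball_vec n (real (Suc \<rho>)). ennreal (limit_density n x) \<partial>lborel_vec n)"
  unfolding ball_mass_def
  using nn_integral_limit_density_finite[of n "real (Suc \<rho>)"] by (intro ennreal_enn2real) auto

lemma measurable_ball_density [measurable]:
  assumes "0 < n"
  shows "ball_density n \<rho> \<in> borel_measurable (borel_vec n)"
proof -
  have [measurable]: "limit_density n \<in> borel_measurable (borel_vec n)"
    using assms by (rule measurable_limit_density)
  show ?thesis unfolding ball_density_def by measurable
qed

lemma ball_density_nonneg: "0 < n \<Longrightarrow> 0 \<le> ball_density n \<rho> x"
  using ball_mass_pos[of n \<rho>] limit_density_pos[of n x] by (simp add: ball_density_def)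

lemma sets_ball_law [simp]: "sets (ball_law n \<rho>) = sets (borel_vec n)"
  by (simp add: ball_law_def)

lemma prob_space_ball_law:
  assumes n: "0 < n"
  shows "prob_space (ball_law n \<rho>)"
proof
  let ?m = "ball_mass n \<rho>" and ?B = "ball_vec n (real (Suc \<rho>))"
  have m: "0 < ?m" using n by (rule ball_mass_pos)
  have [measurable]: "limit_density n \<in> borel_measurable (borel_vec n)"
    using n by (rule measurable_limit_density)
  have "emeasure (ball_law n \<rho>) (space (ball_law n \<rho>)) = (\<integral>\<^sup>+x. ennreal (ball_density n \<rho> x) \<partial>lborel_vec n)"
    unfolding ball_law_def using measurable_ball_density[OF n] sets.top[of "borel_vec n"]
    by (subst emeasure_density) (auto intro!: nn_integral_cong)
  also have "\<dots> = (\<integral>\<^sup>+x. (ennreal (limit_density n x) * indicator ?B x) * ennreal (1 / ?m) \<partial>lborel_vec n)"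
    using m limit_density_pos[THEN less_imp_le]
    by (intro nn_integral_cong) (auto simp: ball_density_def ennreal_mult[symmetric] split: split_indicator)
  also have "\<dots> = ennreal ?m * ennreal (1 / ?m)"
    unfolding ennreal_ball_mass[OF n] by (rule nn_integral_multc) (use n in measurable)
  also have "\<dots> = 1"
    using m by (simp flip: ennreal_mult)
  finally show "emeasure (ball_law n \<rho>) (space (ball_law n \<rho>)) = 1" .
qed

text \<open>Every triple needs a probability law for the product measure; the last case takes in all
  tags from 3 on.\<close>

definition component_law :: "nat \<Rightarrow> real vec measure \<Rightarrow> nat \<times> nat \<times> nat \<Rightarrow> real vec measure" where
  "component_law n \<mu> = (\<lambda>(t, a, b). if t = 0 then marked_law n \<mu> else if t = 1 then poisson_law n (real a)
     else if t = 2 then poisson_law n (ball_mass n a) else marked_law n (ball_law n a))"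

text \<open>The coordinates, indexed by triples coded as natural numbers: \<open>(0, i, 0)\<close> carries \<open>X\<^sub>i\<close> and its
  mark, \<open>(1, N, 0)\<close> the Poisson number of points taken from the sequence when the sample size is
  \<open>N\<close>, while \<open>(2, \<rho>, 0)\<close> and \<open>(3, \<rho>, i)\<close> carry a Poisson process on the ball of radius \<open>\<rho> + 1\<close>.
  Countably many coordinates serve all parameters of the theorem.\<close>

definition sample_space :: "nat \<Rightarrow> real vec measure \<Rightarrow> (nat \<Rightarrow> real vec) measure" where
  "sample_space n \<mu> = (\<Pi>\<^sub>M j\<in>UNIV. component_law n \<mu> (from_nat j))"

lemma sets_component_law [simp]: "sets (component_law n \<mu> c) = sets (borel_vec (Suc n))"
  by (simp add: component_law_def split: prod.split)

lemma prob_space_component_law: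
  assumes "0 < n" "prob_space \<mu>" "sets \<mu> = sets (borel_vec n)"
  shows "prob_space (component_law n \<mu> c)"
  using assms by (auto simp: component_law_def prob_space_marked_law prob_space_poisson_law
      prob_space_ball_law split: prod.split)

lemma measurable_coordinate [measurable]:
  "(\<lambda>\<omega>. \<omega> j) \<in> measurable (sample_space n \<mu>) (borel_vec (Suc n))"
proof -
  have "(\<lambda>\<omega>. \<omega> j) \<in> measurable (sample_space n \<mu>) (component_law n \<mu> (from_nat j))"
    unfolding sample_space_def by (rule measurable_component_singleton) simp
  then show ?thesis
    by (simp only: measurable_cong_sets[OF refl sets_component_law])
qed

lemma prob_space_sample_space:
  assumes "0 < n" "prob_space \<mu>" "sets \<mu> = sets (borel_vec n)"
  shows "prob_space (sample_space n \<mu>)"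
  unfolding sample_space_def by (intro prob_space_PiM prob_space_component_law assms)

lemma distr_coordinate:
  assumes "0 < n" "prob_space \<mu>" "sets \<mu> = sets (borel_vec n)"
  shows "distr (sample_space n \<mu>) (borel_vec (Suc n)) (\<lambda>\<omega>. \<omega> j) = component_law n \<mu> (from_nat j)"
proof -
  have "distr (sample_space n \<mu>) (borel_vec (Suc n)) (\<lambda>\<omega>. \<omega> j) =
      distr (sample_space n \<mu>) (component_law n \<mu> (from_nat j)) (\<lambda>\<omega>. \<omega> j)"
    by (rule distr_cong) auto
  also have "\<dots> = component_law n \<mu> (from_nat j)"
    unfolding sample_space_def
    by (rule distr_PiM_component) (simp_all add: prob_space_component_law assms)
  finally show ?thesis .
qed

text \<open>The joint law of the coordinates is the image of the sample space under the identity,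
  hence the product of the marginal laws.\<close>

lemma indep_vars_coordinates:
  assumes "0 < n" "prob_space \<mu>" "sets \<mu> = sets (borel_vec n)"
  shows "prob_space.indep_vars (sample_space n \<mu>) (\<lambda>_. borel_vec (Suc n)) (\<lambda>j \<omega>. \<omega> j) UNIV"
proof -
  interpret prob_space "sample_space n \<mu>" using assms by (rule prob_space_sample_space)
  have "sets (sample_space n \<mu>) = sets (\<Pi>\<^sub>M j\<in>UNIV. borel_vec (Suc n))"
    unfolding sample_space_def by (rule sets_PiM_cong) auto
  then have "distr (sample_space n \<mu>) (\<Pi>\<^sub>M j\<in>UNIV. borel_vec (Suc n)) (\<lambda>\<omega>. \<lambda>j\<in>UNIV. \<omega> j) = sample_space n \<mu>"
    by (simp only: restrict_UNIV distr_id2)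
  also have "\<dots> = (\<Pi>\<^sub>M j\<in>UNIV. distr (sample_space n \<mu>) (borel_vec (Suc n)) (\<lambda>\<omega>. \<omega> j))"
    unfolding distr_coordinate[OF assms] by (simp add: sample_space_def)
  finally show ?thesis
    by (subst indep_vars_iff_distr_eq_PiM) auto
qed

text \<open>\<open>y\<close>, \<open>T\<close> and \<open>f\<close> are absorbed into the map
  \<open>Z\<close> and the density \<open>h\<close>. The cardinality in the event is the number of
  rescaled sample points in \<open>E\<close>: the codes with \<open>Suc i\<close> for
  \<open>i < N\<close> address X_1, ..., X_N.\<close>

lemma poisson_coupling:
  fixes n N :: nat and \<mu> :: "real vec measure" and Z :: "real vec \<Rightarrow> real vec" and h :: "real vec \<Rightarrow> real"
  assumes n: "0 < n" and \<mu>: "prob_space \<mu>" "sets \<mu> = sets (borel_vec n)"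
    and Z: "Z \<in> measurable (borel_vec n) (borel_vec n)"
    and law: "distr \<mu> (borel_vec n) Z = density (lborel_vec n) (\<lambda>x. ennreal (h x))"
    and h: "h \<in> borel_measurable (borel_vec n)" "\<And>x. x \<in> carrier_vec n \<Longrightarrow> 0 \<le> h x"
    and N: "0 < N" and R: "0 < R" and \<epsilon>: "0 < \<epsilon>" "\<epsilon> < 1"
    and close: "(\<integral>\<^sup>+x\<in>ball_vec n R. ennreal \<bar>limit_density n x - real N * h x\<bar> \<partial>lborel_vec n) < ennreal \<epsilon>"
  obtains \<nu> A where
    "poisson_point_process (sample_space n \<mu>)
      (density (restrict_space (lborel_vec n) (ball_vec n R)) (\<lambda>x. ennreal (limit_density n x))) \<nu>"
    "A = {\<omega>\<in>space (sample_space n \<mu>). \<forall>E\<in>sets (borel_vec n). E \<subseteq> ball_vec n R \<longrightarrow>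
      of_nat (card {i. i < N \<and> Z (pos_vec n (\<omega> (to_nat (0 :: nat, Suc i, 0 :: nat)))) \<in> E}) = emeasure (\<nu> \<omega>) E}"
    "A \<in> sets (sample_space n \<mu>)"
    "measure (sample_space n \<mu>) A \<ge>
      1 - \<epsilon> - (1 + (LINT x:ball_vec n R|lborel_vec n. limit_density n x)) / sqrt N"
proof -
  let ?g = "limit_density n" and ?B = "ball_vec n R" and ?L = "lborel_vec n"
  define M where "M = sample_space n \<mu>"
  interpret prob_space M unfolding M_def using n \<mu> by (rule prob_space_sample_space)
  note Z [measurable] and h(1) [measurable]
  have g [measurable]: "?g \<in> borel_measurable (borel_vec n)" using n by (rule measurable_limit_density)
  have g0: "0 < ?g x" for x by (rule limit_density_pos)
  \<comment> \<open>An integer radius not below \<open>R\<close>: the Poisson process stored for it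
    covers the given ball.\<close>
  obtain \<rho> :: nat where \<rho>: "R \<le> real (Suc \<rho>)"
    using real_arch_simple[of R] by (metis le_SucI of_nat_le_iff order_trans order_refl)
  define m where "m = ball_mass n \<rho>"
  have m: "0 < m" unfolding m_def using n by (rule ball_mass_pos)

  define q where "q b = to_nat (if b then (2 :: nat, \<rho>, 0 :: nat) else (1, N, 0))" for b
  define p where "p b i = to_nat (if b then (3 :: nat, \<rho>, i) else (0, Suc i, 0))" for b i
  define c where "c b = (if b then m else real N)" for b
  define D where "D b = marked_law n (if b then ball_law n \<rho> else \<mu>)" for b
  define pt where "pt b v = (if b then pos_vec n v else Z (pos_vec n v))" for b v
  define w where "w b = (if b then ball_density n \<rho> else h)" for b
  \<comment> \<open>\<open>c b * w b\<close> is the intensity before thinning and \<open>a b\<close>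
    the intended one. For \<open>b = True\<close> the latter may be negative, and a point at such a
    location is almost surely rejected.\<close>
  define a where "a b x = (if b then ?g x - real N * h x else ?g x)" for b x
  define A where "A b E = {v\<in>carrier_vec (Suc n). pt b v \<in> E \<and> v $ 0 * (c b * w b (pt b v)) \<le> a b (pt b v)}" for b E

  have Y: "indep_vars (\<lambda>_. borel_vec (Suc n)) (\<lambda>j \<omega>. \<omega> j) UNIV"
    unfolding M_def using n \<mu> by (rule indep_vars_coordinates)
  have Y_meas [measurable]: "(\<lambda>\<omega>. \<omega> j) \<in> measurable M (borel_vec (Suc n))" for j
    unfolding M_def by (rule measurable_coordinate)
  have inj_p: "inj (p b)" for b by (auto simp: inj_on_def p_def)
  have pp: "range (p False) \<inter> range (p True) = {}" by (auto simp: p_def)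
  have qp: "q b \<notin> range (p b')" for b b' by (auto simp: p_def q_def split: if_splits)
  have qq: "q False \<noteq> q True" by (simp add: q_def)
  have K: "prob {\<omega>\<in>space M. count_vec (\<omega> (q b)) = k} = poisson_prob (c b) k" for b k
  proof -
    have "{v\<in>space (borel_vec (Suc n)). count_vec v = k} \<in> sets (borel_vec (Suc n))" by measurable
    moreover have "(\<lambda>\<omega>. \<omega> (q b)) -` {v\<in>carrier_vec (Suc n). count_vec v = k} \<inter> space M = {\<omega>\<in>space M. count_vec (\<omega> (q b)) = k}"
      using measurable_space[OF Y_meas[of "q b"]] by auto
    ultimately have "prob {\<omega>\<in>space M. count_vec (\<omega> (q b)) = k} =
        measure (distr M (borel_vec (Suc n)) (\<lambda>\<omega>. \<omega> (q b))) {v\<in>carrier_vec (Suc n). count_vec v = k}"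
      by (simp add: measure_distr)
    also have "distr M (borel_vec (Suc n)) (\<lambda>\<omega>. \<omega> (q b)) = poisson_law n (c b)"
      unfolding M_def q_def distr_coordinate[OF n \<mu>] by (simp add: component_law_def c_def m_def)
    also have "measure \<dots> {v\<in>carrier_vec (Suc n). count_vec v = k} = poisson_prob (c b) k"
      using m N by (intro measure_poisson_law_count) (simp add: c_def)
    finally show ?thesis .
  qed
  have D: "distr M (borel_vec (Suc n)) (\<lambda>\<omega>. \<omega> (p b i)) = D b" for b i
    unfolding M_def p_def distr_coordinate[OF n \<mu>] by (simp add: component_law_def D_def)

  have pt [measurable]: "pt b \<in> measurable (borel_vec (Suc n)) (borel_vec n)" for b
    unfolding pt_def by (cases b) simp_all
  have w [measurable]: "w b \<in> borel_measurable (borel_vec n)" for b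
    unfolding w_def using measurable_ball_density[OF n] by simp
  have a [measurable]: "a b \<in> borel_measurable (borel_vec n)" for b
    unfolding a_def by (cases b) simp_all
  have w0: "0 \<le> w b x" if "x \<in> carrier_vec n" for b x
    using h(2)[OF that] ball_density_nonneg[OF n] by (simp add: w_def)
  have A_sets [measurable]: "A b E \<in> sets (borel_vec (Suc n))" if [measurable]: "E \<in> sets (borel_vec n)" for b E
  proof -
    have "{v\<in>space (borel_vec (Suc n)). pt b v \<in> E \<and> v $ 0 * (c b * w b (pt b v)) \<le> a b (pt b v)} \<in> sets (borel_vec (Suc n))"
      by measurable
    then show ?thesis by (simp add: A_def)
  qed
  have D_prob: "prob_space (D b)" for b
    unfolding D_def using prob_space_ball_law[OF n] \<mu> by (auto intro: prob_space_marked_law)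
  have thinned: "ennreal (c b) * emeasure (D b) (A b E) = (\<integral>\<^sup>+x\<in>E. ennreal (min (a b x) (c b * w b x)) \<partial>?L)"
    if E: "E \<in> sets (borel_vec n)" for b E
  proof (cases b)
    case True
    have "distr (ball_law n \<rho>) (borel_vec n) (\<lambda>x. x) = density ?L (\<lambda>x. ennreal (w True x))"
      by (subst distr_id2) (simp_all add: w_def ball_law_def)
    from emeasure_marked_law_thinned[OF prob_space_ball_law[OF n] _ _ this w w0 a[of True] _ E, where s="c True"] m
    show ?thesis using True by (simp add: A_def pt_def D_def c_def)
  next
    case False
    have "distr \<mu> (borel_vec n) Z = density ?L (\<lambda>x. ennreal (w False x))"
      using law by (simp add: w_def)
    from emeasure_marked_law_thinned[OF \<mu> Z this w w0 a[of False] _ E, where s="c False"]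
    show ?thesis using False by (simp add: A_def pt_def D_def c_def)
  qed
  have cmeas: "ennreal (c b * measure (D b) (A b E)) = (\<integral>\<^sup>+x\<in>E. ennreal (min (a b x) (c b * w b x)) \<partial>?L)"
    if "E \<in> sets (borel_vec n)" for b E
  proof -
    interpret D: prob_space "D b" by (rule D_prob)
    show ?thesis
      unfolding thinned[OF that, symmetric] D.emeasure_eq_measure
      by (rule ennreal_mult) (use m in \<open>simp_all add: c_def\<close>)
  qed
  have minF: "min (a False x) (c False * w False x) = min (?g x) (real N * h x)" for x
    by (simp add: a_def c_def w_def)
  \<comment> \<open>Inside the ball the stored process has intensity exactly \<open>?g\<close>, and
    \<open>h\<close> is nonnegative there, so the minimum is the difference itself.\<close>
  have minT: "min (a True x) (c True * w True x) = ?g x - real N * h x" if "x \<in> ?B" for x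
  proof -
    have "x \<in> ball_vec n (real (Suc \<rho>))" "0 \<le> h x" using that \<rho> h(2) by (auto simp: ball_vec_def)
    then show ?thesis using m by (simp add: a_def c_def w_def ball_density_def m_def)
  qed
  have split_g: "ennreal (min (?g x) (real N * h x)) + ennreal (?g x - real N * h x) = ennreal (?g x)"
    if "x \<in> ?B" for x
  proof -
    have "0 \<le> h x" using that h(2) by (auto simp: ball_vec_def)
    then show ?thesis
      using g0[of x] by (cases "?g x \<le> real N * h x") (auto simp: min_def ennreal_neg simp flip: ennreal_plus)
  qed
  have minT_int: "(\<integral>\<^sup>+x\<in>E. ennreal (min (a True x) (c True * w True x)) \<partial>?L) =
      (\<integral>\<^sup>+x\<in>E. ennreal (?g x - real N * h x) \<partial>?L)" if "E \<subseteq> ?B" for E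
    using that by (intro nn_integral_cong) (auto simp: minT split: split_indicator)
  have mass: "(\<integral>\<^sup>+x\<in>E. ennreal (?g x) \<partial>?L) = ennreal (\<Sum>b\<in>UNIV. c b * measure (D b) (A b E))"
    if E [measurable]: "E \<in> sets (borel_vec n)" and EB: "E \<subseteq> ?B" for E
  proof -
    have "(\<integral>\<^sup>+x\<in>E. ennreal (?g x) \<partial>?L) =
        (\<integral>\<^sup>+x. ennreal (min (?g x) (real N * h x)) * indicator E x + ennreal (?g x - real N * h x) * indicator E x \<partial>?L)"
      using EB by (intro nn_integral_cong) (auto simp: split_g split: split_indicator)
    also have "\<dots> = (\<integral>\<^sup>+x\<in>E. ennreal (min (?g x) (real N * h x)) \<partial>?L) + (\<integral>\<^sup>+x\<in>E. ennreal (?g x - real N * h x) \<partial>?L)"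
      by (rule nn_integral_add) measurable
    also have "\<dots> = ennreal (c False * measure (D False) (A False E)) + ennreal (c True * measure (D True) (A True E))"
      unfolding cmeas[OF E] minT_int[OF EB] minF ..
    also have "\<dots> = ennreal (\<Sum>b\<in>UNIV. c b * measure (D b) (A b E))"
      using m by (subst ennreal_plus[symmetric]) (auto simp: UNIV_bool c_def add.commute)
    finally show ?thesis .
  qed

  define \<Lambda> where "\<Lambda> = density (restrict_space ?L ?B) (\<lambda>x. ennreal (?g x))"
  have sets_\<Lambda>: "E \<in> sets \<Lambda> \<longleftrightarrow> E \<in> sets (borel_vec n) \<and> E \<subseteq> ?B" for E
    unfolding \<Lambda>_def using ball_vec_carrier[of n R] by (auto simp: sets_restrict_space_iff Int_absorb2)
  have \<Lambda>: "emeasure \<Lambda> E = ennreal (\<Sum>b\<in>UNIV. c b * measure (D b) (A b E))"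
    if E: "E \<in> sets (borel_vec n)" "E \<subseteq> ?B" for E
  proof -
    note E(1) [measurable]
    have "emeasure \<Lambda> E = (\<integral>\<^sup>+x. ennreal (?g x) * indicator E x \<partial>restrict_space ?L ?B)"
      unfolding \<Lambda>_def using E ball_vec_carrier[of n R]
      by (intro emeasure_density) (auto simp: sets_restrict_space_iff Int_absorb2 intro!: measurable_restrict_space1)
    also have "\<dots> = (\<integral>\<^sup>+x\<in>E. ennreal (?g x) \<partial>?L)"
      using E ball_vec_carrier[of n R]
      by (subst nn_integral_restrict_space) (auto simp: Int_absorb2 intro!: nn_integral_cong split: split_indicator)
    finally show ?thesis using mass[OF E] by simp
  qed
  have \<Lambda>_measure: "measure \<Lambda> E = (\<Sum>b\<in>UNIV. c b * measure (D b) (A b E))"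
    if E: "E \<in> sets (borel_vec n)" "E \<subseteq> ?B" for E
    unfolding measure_def[of \<Lambda>] \<Lambda>[OF E] using m by (intro enn2real_ennreal sum_nonneg) (auto simp: c_def)

  define C where "C E \<omega> = (\<Sum>b\<in>UNIV. card {i. i < count_vec (\<omega> (q b)) \<and> \<omega> (p b i) \<in> A b E})" for E \<omega>
  \<comment> \<open>Retained points are indexed by pairs instead of being collected as a set of
    locations, so coinciding points count with multiplicity.\<close>
  define I where "I \<omega> = (SIGMA b:UNIV. {i. i < count_vec (\<omega> (q b)) \<and> \<omega> (p b i) \<in> A b ?B})" for \<omega>
  define \<nu> where "\<nu> \<omega> = sum_dirac (restrict_space ?L ?B) (I \<omega>) (\<lambda>(b, i). pt b (\<omega> (p b i)))" for \<omega>
  have A_iff: "v \<in> A b E \<longleftrightarrow> v \<in> A b ?B \<and> pt b v \<in> E" if "E \<subseteq> ?B" for v b E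
    using that by (auto simp: A_def)
  have \<nu>: "emeasure (\<nu> \<omega>) E = of_nat (C E \<omega>)" if E: "E \<in> sets (borel_vec n)" "E \<subseteq> ?B" for E \<omega>
  proof -
    have "E \<in> sets (restrict_space ?L ?B)"
      using E ball_vec_carrier[of n R] by (auto simp: sets_restrict_space_iff Int_absorb2)
    then have "emeasure (\<nu> \<omega>) E = (\<Sum>(b, i)\<in>I \<omega>. indicator E (pt b (\<omega> (p b i))))"
      unfolding \<nu>_def by (subst emeasure_sum_dirac) (auto simp: I_def intro!: sum.cong)
    also have "\<dots> = (\<Sum>b\<in>UNIV. \<Sum>i\<in>{i. i < count_vec (\<omega> (q b)) \<and> \<omega> (p b i) \<in> A b ?B}. indicator E (pt b (\<omega> (p b i))))"
      unfolding I_def by (subst sum.Sigma) auto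
    also have "\<dots> = of_nat (C E \<omega>)"
      using E(2) by (simp add: C_def sum_indicator_eq_card A_iff[OF E(2)] conj_assoc)
    finally show ?thesis .
  qed
  have C_meas: "C E \<in> measurable M (count_space UNIV)" if [measurable]: "E \<in> sets (borel_vec n)" for E
  proof -
    have [measurable]: "(\<lambda>\<omega>. card {i. i < count_vec (\<omega> (q b)) \<and> \<omega> (p b i) \<in> A b E}) \<in> measurable M (count_space UNIV)" for b
      by (rule measurable_card_random_bound) measurable
    show ?thesis unfolding C_def by measurable
  qed
  have ppp: "poisson_point_process M \<Lambda> \<nu>"
  proof (rule poisson_point_processI[where C=C])
    fix J and F :: "nat \<Rightarrow> real vec set" and k
    assume J: "finite J" "F ` J \<subseteq> sets \<Lambda>" "disjoint_family_on F J"
    have F: "F j \<in> sets (borel_vec n)" "F j \<subseteq> ?B" if "j \<in> J" for j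
      using J(2) that sets_\<Lambda> by auto
    have disj: "disjoint_family_on (\<lambda>j. A b (F j)) J" for b
      using J(3) by (auto simp: disjoint_family_on_def A_def)
    have "prob {\<omega>\<in>space M. \<forall>j\<in>J. C (F j) \<omega> = k j} =
        (\<Prod>j\<in>J. poisson_prob (\<Sum>b\<in>UNIV. c b * measure (D b) (A b (F j))) (k j))"
      unfolding C_def
      by (rule superposed_poisson_joint[where A="\<lambda>b j. A b (F j)", OF Y inj_p pp qp qq measurable_count_vec K D J(1) A_sets[OF F(1)] disj])
    also have "\<dots> = (\<Prod>j\<in>J. poisson_prob (measure \<Lambda> (F j)) (k j))"
      using \<Lambda>_measure[OF F] by (intro prod.cong) auto
    finally show "prob {\<omega>\<in>space M. \<forall>j\<in>J. C (F j) \<omega> = k j} = (\<Prod>j\<in>J. poisson_prob (measure \<Lambda> (F j)) (k j))" .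
  next
    show "sets (\<nu> \<omega>) = sets \<Lambda>" for \<omega> by (simp add: \<nu>_def \<Lambda>_def)
  qed (use \<Lambda> \<nu> C_meas sets_\<Lambda> in auto)

  let ?pt = "\<lambda>b i \<omega>. pt b (\<omega> (p b i))"
  define EV where "EV = {\<omega>\<in>space M. \<forall>E\<in>sets (borel_vec n). E \<subseteq> ?B \<longrightarrow>
      of_nat (card {i. i < N \<and> Z (pos_vec n (\<omega> (to_nat (0 :: nat, Suc i, 0 :: nat)))) \<in> E}) = emeasure (\<nu> \<omega>) E}"
  have EV: "EV = {\<omega>\<in>space M. \<forall>E\<in>sets (borel_vec n). E \<subseteq> ?B \<longrightarrow> card {i. i < N \<and> ?pt False i \<omega> \<in> E} = C E \<omega>}"
    using \<nu> by (auto simp: EV_def pt_def p_def)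
  \<comment> \<open>The condition over uncountably many Borel sets becomes a countable one on
    multiplicities; this is what makes the event measurable.\<close>
  have EV_points: "EV = {\<omega>\<in>space M. \<forall>d k. ?pt d k \<omega> \<in> ?B \<longrightarrow> card {i. i < N \<and> ?pt False i \<omega> = ?pt d k \<omega>} =
      (\<Sum>b\<in>UNIV. card {i. i < count_vec (\<omega> (q b)) \<and> \<omega> (p b i) \<in> A b ?B \<and> ?pt b i \<omega> = ?pt d k \<omega>})}"
  proof -
    have "C E \<omega> = (\<Sum>b\<in>UNIV. card {i. i < count_vec (\<omega> (q b)) \<and> \<omega> (p b i) \<in> A b ?B \<and> ?pt b i \<omega> \<in> E})"
      if "E \<subseteq> ?B" for E \<omega>
      unfolding C_def using A_iff[OF that] by simp
    then have "(\<forall>E\<in>sets (borel_vec n). E \<subseteq> ?B \<longrightarrow> card {i. i < N \<and> ?pt False i \<omega> \<in> E} = C E \<omega>) \<longleftrightarrow>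
        (\<forall>d k. ?pt d k \<omega> \<in> ?B \<longrightarrow> card {i. i < N \<and> ?pt False i \<omega> = ?pt d k \<omega>} =
          (\<Sum>b\<in>UNIV. card {i. i < count_vec (\<omega> (q b)) \<and> \<omega> (p b i) \<in> A b ?B \<and> ?pt b i \<omega> = ?pt d k \<omega>}))" for \<omega>
      using counts_eq_iff[OF ball_vec_carrier[of n R], where N=N and pt="\<lambda>b i. ?pt b i \<omega>"
          and K="\<lambda>b. count_vec (\<omega> (q b))" and act="\<lambda>b i. \<omega> (p b i) \<in> A b ?B"]
      by simp
    then show ?thesis unfolding EV by (simp only:)
  qed
  have EV_sets: "EV \<in> sets M"
  proof -
    have pt_meas [measurable]: "?pt b i \<in> measurable M (borel_vec n)" for b i by measurable
    have [measurable]: "Measurable.pred M (\<lambda>\<omega>. ?pt b i \<omega> = ?pt d k \<omega>)" for b i d k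
      by (rule pred_eq_borel_vec[OF pt_meas pt_meas])
    have [measurable]: "(\<lambda>\<omega>. card {i. i < N \<and> ?pt False i \<omega> = ?pt d k \<omega>}) \<in> measurable M (count_space UNIV)" for d k
      by (rule measurable_card_random_bound) measurable
    have [measurable]: "(\<lambda>\<omega>. card {i. i < count_vec (\<omega> (q b)) \<and> \<omega> (p b i) \<in> A b ?B \<and> ?pt b i \<omega> = ?pt d k \<omega>})
        \<in> measurable M (count_space UNIV)" for b d k
      by (rule measurable_card_random_bound) measurable
    show ?thesis unfolding EV_points by measurable
  qed

  define H where "H = {v\<in>carrier_vec (Suc n). pt False v \<in> ?B}"
  have H_sets [measurable]: "H \<in> sets (borel_vec (Suc n))"
  proof -
    have "{v\<in>space (borel_vec (Suc n)). pt False v \<in> ?B} \<in> sets (borel_vec (Suc n))" by measurable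
    then show ?thesis by (simp add: H_def)
  qed
  have AH: "A False ?B \<subseteq> H" by (auto simp: A_def H_def)
  let ?K = "\<lambda>\<omega>. count_vec (\<omega> (q False))"
  define E1 where "E1 = (\<Union>i<N. {\<omega>\<in>space M. \<omega> (p False i) \<in> H - A False ?B})"
  define E2 where "E2 = {\<omega>\<in>space M. \<exists>i<count_vec (\<omega> (q True)). \<omega> (p True i) \<in> A True ?B}"
  define E3 where "E3 = {\<omega>\<in>space M. \<exists>i. min N (?K \<omega>) \<le> i \<and> i < max N (?K \<omega>) \<and> \<omega> (p False i) \<in> H}"
  have E_sets: "E1 \<in> sets M" "E2 \<in> sets M" "E3 \<in> sets M"
  proof -
    show "E1 \<in> sets M" unfolding E1_def by measurable
    have "Measurable.pred M (\<lambda>\<omega>. \<exists>i<count_vec (\<omega> (q True)). \<omega> (p True i) \<in> A True ?B)"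
      by (rule measurable_compose_countable[where g="\<lambda>\<omega>. count_vec (\<omega> (q True))"]) measurable
    then show "E2 \<in> sets M" unfolding E2_def by measurable
    have "Measurable.pred M (\<lambda>\<omega>. \<exists>i. min N (?K \<omega>) \<le> i \<and> i < max N (?K \<omega>) \<and> \<omega> (p False i) \<in> H)"
      by (rule measurable_compose_countable[where g="?K"]) measurable
    then show "E3 \<in> sets M" unfolding E3_def by measurable
  qed
  have good: "space M - (E1 \<union> E2 \<union> E3) \<subseteq> EV"
  proof
    fix \<omega> assume \<omega>: "\<omega> \<in> space M - (E1 \<union> E2 \<union> E3)"
    have car: "\<omega> j \<in> carrier_vec (Suc n)" for j
      using measurable_space[OF Y_meas[of j]] \<omega> by auto
    have 1: "\<omega> (p False i) \<in> A False ?B" if "i < N" "?pt False i \<omega> \<in> ?B" for i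
      using \<omega> that car by (auto simp: E1_def H_def)
    have 2: "\<omega> (p True i) \<notin> A True ?B" if "i < count_vec (\<omega> (q True))" for i
      using \<omega> that by (auto simp: E2_def)
    have 3: "i < N \<longleftrightarrow> i < ?K \<omega>" if "?pt False i \<omega> \<in> ?B" for i
    proof (rule ccontr)
      assume "\<not> (i < N \<longleftrightarrow> i < ?K \<omega>)"
      then have "min N (?K \<omega>) \<le> i \<and> i < max N (?K \<omega>)" by auto
      then show False using \<omega> that car by (auto simp: E3_def H_def)
    qed
    have "card {i. i < N \<and> ?pt False i \<omega> \<in> E} = C E \<omega>" if E: "E \<subseteq> ?B" for E
    proof -
      have "{i. i < count_vec (\<omega> (q True)) \<and> \<omega> (p True i) \<in> A True E} = {}"
        using 2 A_iff[OF E] by auto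
      moreover have "{i. i < ?K \<omega> \<and> \<omega> (p False i) \<in> A False E} = {i. i < N \<and> ?pt False i \<omega> \<in> E}"
        using 1 3 E A_iff[OF E] by auto
      ultimately show ?thesis by (simp add: C_def UNIV_bool)
    qed
    then show "\<omega> \<in> EV" using \<omega> by (auto simp: EV)
  qed

  \<comment> \<open>These turn out to be the integrals over the ball of N h, of min(g, N h), of the
    positive part of g - N h, and of g.\<close>
  define a0 a1 a2 l where "a0 = real N * measure (D False) H" and "a1 = c False * measure (D False) (A False ?B)"
    and "a2 = c True * measure (D True) (A True ?B)" and "l = (LINT x:?B|?L. ?g x)"
  interpret DF: prob_space "D False" by (rule D_prob)
  have a_nonneg: "0 \<le> a0" "0 \<le> a1" "0 \<le> a2" using m by (auto simp: a0_def a1_def a2_def c_def)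
  have DS: "sets (D b) = sets (borel_vec (Suc n))" for b by (simp add: D_def)
  have P1: "prob E1 \<le> a0 - a1"
  proof -
    have "prob E1 \<le> (\<Sum>i<N. prob {\<omega>\<in>space M. \<omega> (p False i) \<in> H - A False ?B})"
      unfolding E1_def by (rule finite_measure_subadditive_finite) auto
    also have "\<dots> = (\<Sum>i<N. measure (D False) (H - A False ?B))"
    proof (rule sum.cong[OF refl])
      fix i
      have "H - A False ?B \<in> sets (borel_vec (Suc n))" by measurable
      then show "prob {\<omega>\<in>space M. \<omega> (p False i) \<in> H - A False ?B} = measure (D False) (H - A False ?B)"
        by (simp add: measure_distr Y_meas vimage_def Int_def conj_commute flip: D[of False i])
    qed
    also have "\<dots> = a0 - a1"
      using DF.finite_measure_Diff[OF _ _ AH] by (simp add: a0_def a1_def c_def DS right_diff_distrib)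
    finally show ?thesis .
  qed
  have P2: "prob E2 \<le> a2"
    unfolding E2_def a2_def
    by (rule prob_poisson_point_in_le[OF Y inj_p qp measurable_count_vec K D]) simp
  have P3: "prob E3 \<le> sqrt N * measure (D False) H"
    unfolding E3_def
    by (rule prob_point_between_le[OF Y qp measurable_count_vec _ D H_sets N]) (simp add: K c_def)
  have B: "?B \<in> sets (borel_vec n)" by measurable
  have I0: "ennreal a0 = (\<integral>\<^sup>+x\<in>?B. ennreal (real N * h x) \<partial>?L)"
  proof -
    have sp: "space \<mu> = carrier_vec n" using sets_eq_imp_space_eq[OF \<mu>(2)] by simp
    have Z\<mu>: "Z \<in> measurable \<mu> (borel_vec n)" using Z by (simp only: measurable_cong_sets[OF \<mu>(2) refl])
    have ZB: "{x\<in>space (borel_vec n). Z x \<in> ?B} \<in> sets (borel_vec n)" by measurable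
    have "emeasure (D False) H = emeasure (distr (D False) (borel_vec n) (pos_vec n)) {x\<in>space (borel_vec n). Z x \<in> ?B}"
      using ZB measurable_pos_vec[of n] measurable_space[OF measurable_pos_vec[of n]]
      by (subst emeasure_distr) (auto simp: D_def H_def pt_def measurable_cong_sets[OF sets_marked_law refl]
          sets_eq_imp_space_eq[OF sets_marked_law] intro!: arg_cong[where f="emeasure _"])
    also have "distr (D False) (borel_vec n) (pos_vec n) = \<mu>"
      unfolding D_def using distr_pos_marked_law[OF \<mu>(2)] by simp
    also have "emeasure \<mu> {x\<in>space (borel_vec n). Z x \<in> ?B} = emeasure (distr \<mu> (borel_vec n) Z) ?B"
      using Z\<mu> B sp by (subst emeasure_distr) (auto intro!: arg_cong[where f="emeasure _"])
    also have "\<dots> = (\<integral>\<^sup>+x\<in>?B. ennreal (h x) \<partial>?L)"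
      unfolding law by (rule emeasure_density) (use B in auto)
    finally have "ennreal (real N) * emeasure (D False) H = (\<integral>\<^sup>+x. ennreal (real N) * (ennreal (h x) * indicator ?B x) \<partial>?L)"
      by (simp add: nn_integral_cmult)
    also have "\<dots> = (\<integral>\<^sup>+x\<in>?B. ennreal (real N * h x) \<partial>?L)"
      using h(2) by (intro nn_integral_cong) (auto simp: ennreal_mult ball_vec_def split: split_indicator)
    finally show ?thesis
      by (simp add: a0_def DF.emeasure_eq_measure ennreal_mult)
  qed
  have I1: "ennreal a1 = (\<integral>\<^sup>+x\<in>?B. ennreal (min (?g x) (real N * h x)) \<partial>?L)"
    unfolding a1_def cmeas[OF B] minF ..
  have I2: "ennreal a2 = (\<integral>\<^sup>+x\<in>?B. ennreal (?g x - real N * h x) \<partial>?L)"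
    unfolding a2_def cmeas[OF B] minT_int[OF subset_refl] ..
  \<comment> \<open>The rejected mass: it equals the difference of \<open>a0\<close> and
    \<open>a1\<close>, and together with \<open>a2\<close> it makes up the integral in
    \<open>close\<close>.\<close>
  define d where "d = (\<integral>\<^sup>+x\<in>?B. ennreal (real N * h x - ?g x) \<partial>?L)"
  have d01: "ennreal a0 = ennreal a1 + d"
  proof -
    have "ennreal a0 = (\<integral>\<^sup>+x. ennreal (min (?g x) (real N * h x)) * indicator ?B x + ennreal (real N * h x - ?g x) * indicator ?B x \<partial>?L)"
      unfolding I0
    proof (rule nn_integral_cong)
      fix x
      show "ennreal (real N * h x) * indicator ?B x =
        ennreal (min (?g x) (real N * h x)) * indicator ?B x + ennreal (real N * h x - ?g x) * indicator ?B x"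
        using g0[of x]
        by (cases "?g x \<le> real N * h x") (auto simp: min_def ennreal_neg simp flip: ennreal_plus split: split_indicator)
    qed
    also have "\<dots> = ennreal a1 + d"
      unfolding I1 d_def by (rule nn_integral_add) measurable
    finally show ?thesis .
  qed
  have d2: "d + ennreal a2 < ennreal \<epsilon>"
  proof -
    have "d + ennreal a2 = (\<integral>\<^sup>+x. ennreal (real N * h x - ?g x) * indicator ?B x + ennreal (?g x - real N * h x) * indicator ?B x \<partial>?L)"
      unfolding I2 d_def by (rule nn_integral_add[symmetric]) measurable
    also have "\<dots> = (\<integral>\<^sup>+x\<in>?B. ennreal \<bar>?g x - real N * h x\<bar> \<partial>?L)"
    proof (rule nn_integral_cong)
      fix x
      show "ennreal (real N * h x - ?g x) * indicator ?B x + ennreal (?g x - real N * h x) * indicator ?B x =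
        ennreal \<bar>?g x - real N * h x\<bar> * indicator ?B x"
        by (cases "?g x \<le> real N * h x") (auto simp: ennreal_neg abs_if split: split_indicator)
    qed
    finally show ?thesis using close by simp
  qed
  \<comment> \<open>This makes \<open>d\<close> finite, so that the relations between extended
    integrals can be read as relations between reals.\<close>
  have "d \<le> ennreal a0" unfolding d01 by simp
  then obtain d' where d': "d = ennreal d'" "0 \<le> d'"
    by (cases d) (auto simp: top_unique)
  have r1: "a0 = a1 + d'"
    using d01 a_nonneg d' by (simp flip: ennreal_plus)
  have r2: "d' + a2 < \<epsilon>"
    using d2 a_nonneg d' \<epsilon> by (simp flip: ennreal_plus add: ennreal_less_iff)
  have r3: "l = a1 + a2"
  proof -
    have "l = enn2real (ennreal (\<Sum>b\<in>UNIV. c b * measure (D b) (A b ?B)))"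
      unfolding l_def set_integral_limit_density[OF n] mass[OF B subset_refl] ..
    also have "(\<Sum>b\<in>UNIV. c b * measure (D b) (A b ?B)) = a1 + a2"
      by (simp add: UNIV_bool a1_def a2_def)
    also have "enn2real (ennreal (a1 + a2)) = a1 + a2"
      using a_nonneg by (intro enn2real_ennreal) simp
    finally show ?thesis .
  qed
  \<comment> \<open>Here \<open>a0 = a1 + d'\<close> with \<open>a1 \<le> l\<close> and
    \<open>d' < \<epsilon> < 1\<close>.\<close>
  have "a0 \<le> 1 + l" using r1 r2 r3 \<epsilon> a_nonneg by linarith
  then have P3': "prob E3 \<le> (1 + l) / sqrt N"
  proof -
    \<comment> \<open>\<open>a0\<close> contains the factor \<open>N\<close>, so the standard
      deviation sqrt N of the Poisson number turns into the factor 1 / sqrt N.\<close>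
    have "sqrt N * measure (D False) H = a0 / sqrt N"
      using N by (simp add: a0_def field_simps)
    also have "\<dots> \<le> (1 + l) / sqrt N"
      using \<open>a0 \<le> 1 + l\<close> by (intro divide_right_mono) auto
    finally show ?thesis using P3 by simp
  qed
  have "prob (E1 \<union> E2 \<union> E3) \<le> prob E1 + prob E2 + prob E3"
    using measure_subadditive[of "E1 \<union> E2" M E3] measure_subadditive[of E1 M E2] E_sets by auto
  then have "prob (E1 \<union> E2 \<union> E3) \<le> \<epsilon> + (1 + l) / sqrt N"
    using P1 P2 P3' r1 r2 by linarith
  moreover have "prob (space M - (E1 \<union> E2 \<union> E3)) = 1 - prob (E1 \<union> E2 \<union> E3)"
    by (rule prob_compl) (use E_sets in auto)
  moreover have "prob (space M - (E1 \<union> E2 \<union> E3)) \<le> prob EV"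
    using good EV_sets by (rule finite_measure_mono)
  ultimately have "prob EV \<ge> 1 - \<epsilon> - (1 + l) / sqrt N" by linarith
  with that[OF ppp[unfolded M_def \<Lambda>_def] EV_def[unfolded M_def] EV_sets[unfolded M_def]]
  show ?thesis unfolding M_def l_def by blast
qed

section \<open>Inverse matrices and the final estimate\<close>

lemma the_mat_inverse:
  fixes T :: "real mat"
  assumes T: "T \<in> carrier_mat n n" "invertible_mat T"
  shows "the (mat_inverse T) \<in> carrier_mat n n" "the (mat_inverse T) * T = 1\<^sub>m n"
proof -
  obtain B where B: "T * B = 1\<^sub>m n" "B * T = 1\<^sub>m (dim_row B)"
    using T by (auto simp: invertible_mat_def inverts_mat_def)
  have "dim_col B = n" using arg_cong[OF B(1), of dim_col] by simp
  moreover have "dim_row B = n" using arg_cong[OF B(2), of dim_col] T by simp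
  ultimately have "B \<in> carrier_mat n n" by auto
  \<comment> \<open>\<open>mat_inverse\<close> is specified through the units of the matrix ring,
    and a nonzero determinant leads there.\<close>
  then have "det T * det B = 1" using det_mult[OF T(1)] B(1) by (metis det_one)
  then have "det T \<noteq> 0" by auto
  then have "T \<in> Units (ring_mat TYPE(real) n ())" by (rule det_non_zero_imp_unit[OF T(1)])
  then obtain S where "mat_inverse T = Some S"
    using mat_inverse(1)[OF T(1), where b="()"] by (cases "mat_inverse T") auto
  then show "the (mat_inverse T) \<in> carrier_mat n n" "the (mat_inverse T) * T = 1\<^sub>m n"
    using mat_inverse(2)[OF T(1)] by auto
qed

text \<open>For N \<ge> 2 already 3 sqrt(ln N) \<ge> 1, because ln 2 \<ge> 2/3 > 1/9, so the third
  term alone absorbs (1 + l) / sqrt N. This is the origin of the threshold 1 in the theorem.\<close>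

lemma error_bound:
  assumes N: "1 < N" and l: "0 \<le> l"
  shows "1 - \<epsilon> - 2 * real N powr (- 1 / 4) - 3 * sqrt (ln (real N) / real N) * (1 + l) \<le>
    1 - \<epsilon> - (1 + l) / sqrt N"
proof -
  have "ln 2 \<le> ln (real N)" using N by simp
  then have "(1 / 3)\<^sup>2 \<le> ln (real N)" using ln2_ge_two_thirds by (simp add: power2_eq_square)
  then have "1 / 3 \<le> sqrt (ln (real N))" by (rule real_le_rsqrt)
  then have "1 / sqrt N \<le> 3 * sqrt (ln (real N) / real N)"
    using N by (simp add: real_sqrt_divide divide_right_mono field_simps)
  then have "(1 + l) * (1 / sqrt N) \<le> 3 * sqrt (ln (real N) / real N) * (1 + l)"
    using l by (subst mult.commute, intro mult_right_mono) auto
  moreover have "0 \<le> real N powr (- 1 / 4)" by simp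
  moreover have "(1 + l) * (1 / sqrt N) = (1 + l) / sqrt N" by simp
  ultimately show ?thesis by linarith
qed

theorem theorem3:
  shows "\<exists>N\<^sub>0::nat. \<forall>n\<ge>2. \<forall>(\<mu> :: real vec measure) (f :: real vec \<Rightarrow> real).
    prob_space \<mu> \<and>
    f \<in> borel_measurable (lborel_vec n) \<and> (\<forall>x\<in>carrier_vec n. 0 \<le> f x) \<and>
    \<mu> = density (lborel_vec n) (\<lambda>x. ennreal (f x)) \<longrightarrow>
    (\<exists>(M :: (nat \<Rightarrow> real vec) measure) (X :: nat \<Rightarrow> (nat \<Rightarrow> real vec) \<Rightarrow> real vec).
      prob_space M \<and>
      prob_space.indep_vars M (\<lambda>_. borel_vec n) X {1..} \<and>
      (\<forall>i\<ge>1. distr M (borel_vec n) (X i) = \<mu>) \<and>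
      (\<forall>(N::nat) (y :: real vec) (T :: real mat) (\<epsilon>::real) (R::real).
        N > N\<^sub>0 \<and> y \<in> carrier_vec n \<and> T \<in> carrier_mat n n \<and> invertible_mat T \<and>
        0 < \<epsilon> \<and> \<epsilon> < 1 \<and> 0 < R \<and>
        (\<integral>\<^sup>+ x\<in>ball_vec n R.
           ennreal \<bar>limit_density n x - real N * det T * f (y + T *\<^sub>v x)\<bar> \<partial>lborel_vec n) < ennreal \<epsilon> \<longrightarrow>
        (\<exists>\<nu> :: (nat \<Rightarrow> real vec) \<Rightarrow> real vec measure.
          poisson_point_process M
            (density (restrict_space (lborel_vec n) (ball_vec n R)) (\<lambda>x. ennreal (limit_density n x))) \<nu> \<and>
          (let \<nu>\<^sub>N = (\<lambda>\<omega>. sum_dirac (borel_vec n) {1..N}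
                          (\<lambda>i. the (mat_inverse T) *\<^sub>v (X i \<omega> - y)));
               A = {\<omega> \<in> space M. \<forall>E\<in>sets (borel_vec n). E \<subseteq> ball_vec n R \<longrightarrow>
                      emeasure (\<nu>\<^sub>N \<omega>) E = emeasure (\<nu> \<omega>) E}
           in A \<in> sets M \<and>
              measure M A \<ge> 1 - \<epsilon> - 2 * real N powr (- 1 / 4)
                - 3 * sqrt (ln (real N) / real N)
                    * (1 + (LINT x:ball_vec n R|lborel_vec n. limit_density n x))))))"
proof (rule exI[of _ 1], intro allI impI)
  fix n :: nat and \<mu> :: "real vec measure" and f :: "real vec \<Rightarrow> real"
  assume n2: "2 \<le> n" and as: "prob_space \<mu> \<and>
    f \<in> borel_measurable (lborel_vec n) \<and> (\<forall>x\<in>carrier_vec n. 0 \<le> f x) \<and>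
    \<mu> = density (lborel_vec n) (\<lambda>x. ennreal (f x))"
  then have n: "0 < n" and \<mu>: "prob_space \<mu>" "sets \<mu> = sets (borel_vec n)"
    and f [measurable]: "f \<in> borel_measurable (borel_vec n)" and f0: "\<And>x. x \<in> carrier_vec n \<Longrightarrow> 0 \<le> f x"
    and \<mu>_eq: "\<mu> = density (lborel_vec n) (\<lambda>x. ennreal (f x))"
    by auto
  \<comment> \<open>The space and the sequence are built from \<open>n\<close> and
    \<open>\<mu>\<close> alone, as the order of the quantifiers demands.\<close>
  define M where "M = sample_space n \<mu>"
  define X where "X i \<omega> = pos_vec n (\<omega> (to_nat (0 :: nat, i :: nat, 0 :: nat)))" for i and \<omega> :: "nat \<Rightarrow> real vec"
  have prob: "prob_space M" unfolding M_def using n \<mu> by (rule prob_space_sample_space)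
  have indep: "prob_space.indep_vars M (\<lambda>_. borel_vec n) X {1..}"
  proof -
    have "prob_space.indep_vars M (\<lambda>_. borel_vec (Suc n)) (\<lambda>j \<omega>. \<omega> j) UNIV"
      unfolding M_def using n \<mu> by (rule indep_vars_coordinates)
    then have "prob_space.indep_vars M (\<lambda>_. borel_vec (Suc n)) (\<lambda>i \<omega>. \<omega> (to_nat (0 :: nat, i :: nat, 0 :: nat))) {1..}"
      by (rule prob_space.indep_vars_reindex_inj[OF prob]) (auto simp: inj_on_def)
    then show ?thesis
      unfolding X_def by (rule prob_space.indep_vars_compose2[OF prob]) (rule measurable_pos_vec)
  qed
  have law: "distr M (borel_vec n) (X i) = \<mu>" for i
  proof -
    have "distr M (borel_vec n) (X i) =
        distr (distr M (borel_vec (Suc n)) (\<lambda>\<omega>. \<omega> (to_nat (0 :: nat, i, 0 :: nat)))) (borel_vec n) (pos_vec n)"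
      unfolding X_def M_def by (subst distr_distr[OF measurable_pos_vec measurable_coordinate]) (simp add: comp_def)
    also have "\<dots> = distr (marked_law n \<mu>) (borel_vec n) (pos_vec n)"
      unfolding M_def distr_coordinate[OF n \<mu>] by (simp add: component_law_def)
    also have "\<dots> = \<mu>" by (rule distr_pos_marked_law[OF \<mu>(2)])
    finally show ?thesis .
  qed
  have main: "\<exists>\<nu> :: (nat \<Rightarrow> real vec) \<Rightarrow> real vec measure.
      poisson_point_process M
        (density (restrict_space (lborel_vec n) (ball_vec n R)) (\<lambda>x. ennreal (limit_density n x))) \<nu> \<and>
      (let \<nu>\<^sub>N = (\<lambda>\<omega>. sum_dirac (borel_vec n) {1..N} (\<lambda>i. the (mat_inverse T) *\<^sub>v (X i \<omega> - y)));
           A = {\<omega> \<in> space M. \<forall>E\<in>sets (borel_vec n). E \<subseteq> ball_vec n R \<longrightarrow>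
                  emeasure (\<nu>\<^sub>N \<omega>) E = emeasure (\<nu> \<omega>) E}
       in A \<in> sets M \<and>
          measure M A \<ge> 1 - \<epsilon> - 2 * real N powr (- 1 / 4)
            - 3 * sqrt (ln (real N) / real N) * (1 + (LINT x:ball_vec n R|lborel_vec n. limit_density n x)))"
    if N: "N > 1" and y: "y \<in> carrier_vec n" and T: "T \<in> carrier_mat n n" "invertible_mat T"
      and \<epsilon>: "0 < \<epsilon>" "\<epsilon> < 1" and R: "0 < R"
      and close: "(\<integral>\<^sup>+ x\<in>ball_vec n R.
        ennreal \<bar>limit_density n x - real N * det T * f (y + T *\<^sub>v x)\<bar> \<partial>lborel_vec n) < ennreal \<epsilon>"
    for N :: nat and y T \<epsilon> R
  proof -
    define S where "S = the (mat_inverse T)"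
    have S: "S \<in> carrier_mat n n" "S * T = 1\<^sub>m n" unfolding S_def using the_mat_inverse[OF T] by auto
    define Z where "Z x = S *\<^sub>v (x - y)" for x
    \<comment> \<open>The density of the rescaled points needs the absolute value of the
      determinant, whereas the hypothesis has the signed one; \<open>close'\<close> bridges the
      two.\<close>
    define h where "h x = \<bar>det T\<bar> * f (y + T *\<^sub>v x)" for x
    have aff: "(\<lambda>x. y + T *\<^sub>v x) \<in> measurable (borel_vec n) (borel_vec n)"
      using y T by (intro measurable_add_vec) auto
    have h: "h \<in> borel_measurable (borel_vec n)"
      unfolding h_def using measurable_compose[OF aff f] by measurable
    have h0: "0 \<le> h x" if "x \<in> carrier_vec n" for x
      unfolding h_def using f0[of "y + T *\<^sub>v x"] y T that by auto
    have Z: "Z \<in> measurable (borel_vec n) (borel_vec n)"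
      unfolding Z_def by (rule measurable_compose[OF measurable_minus_vec measurable_mult_mat_vec[OF S(1)]]) (use y in auto)
    have "distr \<mu> (borel_vec n) Z = density (lborel_vec n) (\<lambda>x. ennreal \<bar>det T\<bar> * ennreal (f (y + T *\<^sub>v x)))"
      unfolding \<mu>_eq Z_def by (rule distr_density_affine[OF _ y T(1) S]) measurable
    then have law_Z: "distr \<mu> (borel_vec n) Z = density (lborel_vec n) (\<lambda>x. ennreal (h x))"
      by (simp add: h_def ennreal_mult')
    \<comment> \<open>The sign of the determinant only makes the hypothesis stronger.\<close>
    have "(\<integral>\<^sup>+x\<in>ball_vec n R. ennreal \<bar>limit_density n x - real N * h x\<bar> \<partial>lborel_vec n) \<le>
        (\<integral>\<^sup>+x\<in>ball_vec n R. ennreal \<bar>limit_density n x - real N * det T * f (y + T *\<^sub>v x)\<bar> \<partial>lborel_vec n)"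
    proof (intro nn_integral_mono mult_right_mono ennreal_leI)
      fix x assume "x \<in> space (lborel_vec n)"
      then have "0 \<le> f (y + T *\<^sub>v x)" using f0[of "y + T *\<^sub>v x"] y T by auto
      then have "0 \<le> real N * \<bar>det T\<bar> * f (y + T *\<^sub>v x)" by simp
      then show "\<bar>limit_density n x - real N * h x\<bar> \<le> \<bar>limit_density n x - real N * det T * f (y + T *\<^sub>v x)\<bar>"
        using limit_density_pos[of n x] by (cases "0 \<le> det T") (simp_all add: h_def abs_if mult.assoc)
    qed simp
    then have close': "(\<integral>\<^sup>+x\<in>ball_vec n R. ennreal \<bar>limit_density n x - real N * h x\<bar> \<partial>lborel_vec n) < ennreal \<epsilon>"
      using close by (rule le_less_trans)
    have N0: "0 < N" using N by simp
    obtain \<nu> A where \<nu>: "poisson_point_process M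
        (density (restrict_space (lborel_vec n) (ball_vec n R)) (\<lambda>x. ennreal (limit_density n x))) \<nu>"
      and A: "A = {\<omega>\<in>space M. \<forall>E\<in>sets (borel_vec n). E \<subseteq> ball_vec n R \<longrightarrow>
        of_nat (card {i. i < N \<and> Z (X (Suc i) \<omega>) \<in> E}) = emeasure (\<nu> \<omega>) E}" "A \<in> sets M"
      and PA: "measure M A \<ge> 1 - \<epsilon> - (1 + (LINT x:ball_vec n R|lborel_vec n. limit_density n x)) / sqrt N"
      using poisson_coupling[OF n \<mu> Z law_Z h h0 N0 R \<epsilon> close'] unfolding M_def X_def by blast
    \<comment> \<open>The sum over {1..N} is shifted to \<open>i < N\<close> to meet the indexing of
      the coupling.\<close>
    have emp: "emeasure (sum_dirac (borel_vec n) {1..N} (\<lambda>i. the (mat_inverse T) *\<^sub>v (X i \<omega> - y))) E =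
        of_nat (card {i. i < N \<and> Z (X (Suc i) \<omega>) \<in> E})" if "E \<in> sets (borel_vec n)" for \<omega> E
    proof -
      have "emeasure (sum_dirac (borel_vec n) {1..N} (\<lambda>i. the (mat_inverse T) *\<^sub>v (X i \<omega> - y))) E =
          (\<Sum>i<N. indicator E (Z (X (Suc i) \<omega>)))"
        using that by (simp only: emeasure_sum_dirac finite_atLeastAtMost One_nat_def sum.atLeast1_atMost_eq Z_def S_def)
      then show ?thesis by (simp add: sum_indicator_eq_card)
    qed
    have "0 \<le> (LINT x:ball_vec n R|lborel_vec n. limit_density n x)"
      unfolding set_integral_limit_density[OF n] by simp
    from order_trans[OF error_bound[OF N this] PA]
    have bound: "measure M A \<ge> 1 - \<epsilon> - 2 * real N powr (- 1 / 4)
        - 3 * sqrt (ln (real N) / real N) * (1 + (LINT x:ball_vec n R|lborel_vec n. limit_density n x))" .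
    have A': "{\<omega> \<in> space M. \<forall>E\<in>sets (borel_vec n). E \<subseteq> ball_vec n R \<longrightarrow>
        emeasure (sum_dirac (borel_vec n) {1..N} (\<lambda>i. the (mat_inverse T) *\<^sub>v (X i \<omega> - y))) E = emeasure (\<nu> \<omega>) E} = A"
      unfolding A(1) using emp by auto
    show ?thesis
      unfolding Let_def by (intro exI[of _ \<nu>] conjI \<nu>) (simp_all only: A' A(2) bound)
  qed
  show "\<exists>(M :: (nat \<Rightarrow> real vec) measure) (X :: nat \<Rightarrow> (nat \<Rightarrow> real vec) \<Rightarrow> real vec).
      prob_space M \<and>
      prob_space.indep_vars M (\<lambda>_. borel_vec n) X {1..} \<and>
      (\<forall>i\<ge>1. distr M (borel_vec n) (X i) = \<mu>) \<and>
      (\<forall>(N::nat) (y :: real vec) (T :: real mat) (\<epsilon>::real) (R::real).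
        N > 1 \<and> y \<in> carrier_vec n \<and> T \<in> carrier_mat n n \<and> invertible_mat T \<and>
        0 < \<epsilon> \<and> \<epsilon> < 1 \<and> 0 < R \<and>
        (\<integral>\<^sup>+ x\<in>ball_vec n R.
           ennreal \<bar>limit_density n x - real N * det T * f (y + T *\<^sub>v x)\<bar> \<partial>lborel_vec n) < ennreal \<epsilon> \<longrightarrow>
        (\<exists>\<nu> :: (nat \<Rightarrow> real vec) \<Rightarrow> real vec measure.
          poisson_point_process M
            (density (restrict_space (lborel_vec n) (ball_vec n R)) (\<lambda>x. ennreal (limit_density n x))) \<nu> \<and>
          (let \<nu>\<^sub>N = (\<lambda>\<omega>. sum_dirac (borel_vec n) {1..N}
                          (\<lambda>i. the (mat_inverse T) *\<^sub>v (X i \<omega> - y)));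
               A = {\<omega> \<in> space M. \<forall>E\<in>sets (borel_vec n). E \<subseteq> ball_vec n R \<longrightarrow>
                      emeasure (\<nu>\<^sub>N \<omega>) E = emeasure (\<nu> \<omega>) E}
           in A \<in> sets M \<and>
              measure M A \<ge> 1 - \<epsilon> - 2 * real N powr (- 1 / 4)
                - 3 * sqrt (ln (real N) / real N)
                    * (1 + (LINT x:ball_vec n R|lborel_vec n. limit_density n x)))))"
    by (intro exI[of _ M] exI[of _ X] conjI prob indep allI impI law main) auto
qed

end
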